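(* Suppose that all stationary states of the SSM on $\widehat X^*_e$ are translation invariant. Then every ETIS state $\mu$ of the SSM on $\widehat X^*$ of density $\hat\rho$ is of the form $\gamma_*(\mu_*\times\lambda)$, with $\lambda$ an ergodic translation invariant probability measure on $S=\{0,1\}^{\mathbb Z}$ of some density $\kappa$ and $\mu_*\in\overline{\mathcal N}_{\hat\rho_e}$, where $\hat\rho_e=\hat\rho-\kappa$. Conversely, every state of this form is ETIS.
   Context: SSM (symmetric stack model): the discrete-time Markov process on $\widehat X=\mathbb Z_+^{\mathbb Z}$, $\mathbb Z_+=\{0,1,2,\dots\}$. A stack $\mathbf n(i)$ is short if $\mathbf n(i)\le1$ and tall otherwise. In passing from $\mathbf n_t$ to $\mathbf n_{t+1}$, simultaneously for each bond $\langle k,k+1\rangle$: if both stacks are short no particle crosses the bond; if one is short and one tall, one particle moves from the tall to the short stack; if both are tall, one particle moves across the bond in a direction chosen with probability $1/2$ each (independently for different bonds). $\widehat X^*\subset\widehat X$ is the set of configurations with no two adjacent short stacks, and $\widehat X^*_e\subset\widehat X^*$ is the subset of configurations with every $\mathbf n(i)$ even; both are invariant under the dynamics. $\gamma:\widehat X^*_e\times S\to\widehat X^*$ is $\gamma(\mathbf m,\sigma)=\mathbf m+\sigma$ (site by site), and $\gamma_*$ denotes push-forward of measures. States are Borel probability measures; TIS = translation invariant and stationary; ETIS = extremal among TIS states. A state has density $\hat\rho$ ($<\infty$) if almost every configuration satisfies $\lim_{N}\frac1N\sum_{i=1}^N\mathbf n(i)=\lim_{N}\frac1N\sum_{i=-N}^{-1}\mathbf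 n(i)=\hat\rho$; similarly for measures on $S$. $\mathcal N_{\hat\rho_e}$ is the family of all stationary states of the SSM on $\widehat X^*_e$ (translation invariant or not) with density $\hat\rho_e$, and $\overline{\mathcal N}_{\hat\rho_e}$ is the set of extremal elements of $\mathcal N_{\hat\rho_e}$. *)

theory Defs
  imports "HOL-Probability.Probability"
begin

type_synonym config = "int \<Rightarrow> nat"

definition short :: "nat \<Rightarrow> bool" where
  "short a \<longleftrightarrow> a \<le> 1"

definition X_star :: "config set" where
  "X_star = {n. \<forall>i. \<not> (short (n i) \<and> short (n (i + 1)))}"

definition X_star_even :: "config set" where
  "X_star_even = {n \<in> X_star. \<forall>i. even (n i)}"

text \<open>The space \<open>S\<close> of zero-one configurations, as a subset of the same configuration space.\<close>

definition S_bin :: "config set" where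
  "S_bin = {s. \<forall>i. s i \<in> {0, 1}}"


subsection \<open>Dynamics\<close>

text \<open>Net number of particles crossing the bond between \<open>k\<close> and \<open>k + 1\<close> from left to right;
  the bit \<open>w k\<close> is only used when both stacks are tall.\<close>

definition flux :: "config \<Rightarrow> (int \<Rightarrow> bool) \<Rightarrow> int \<Rightarrow> int" where
  "flux n w k =
    (if short (n k) \<and> short (n (k + 1)) then 0
     else if short (n k) then - 1
     else if short (n (k + 1)) then 1
     else if w k then 1 else - 1)"

definition ssm_step :: "config \<Rightarrow> (int \<Rightarrow> bool) \<Rightarrow> config" where
  "ssm_step n w = (\<lambda>i. nat (int (n i) + flux n w (i - 1) - flux n w i))"

text \<open>The truncation by \<^const>\<open>nat\<close> is never active:\<close>

lemma int_ssm_step: "int (ssm_step n w i) = int (n i) + flux n w (i - 1) - flux n w i"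
  by (auto simp: ssm_step_def flux_def short_def)

lemma ssm_step_X_star:
  assumes "n \<in> X_star"
  shows "ssm_step n w \<in> X_star"
proof -
  have "\<not> (short (ssm_step n w i) \<and> short (ssm_step n w (i + 1)))" for i
  proof -
    have "\<not> (short (n (i - 1)) \<and> short (n i))" "\<not> (short (n i) \<and> short (n (i + 1)))"
      "\<not> (short (n (i + 1)) \<and> short (n (i + 2)))"
      using assms[unfolded X_star_def, simplified, rule_format, of "i - 1"]
        assms[unfolded X_star_def, simplified, rule_format, of i]
        assms[unfolded X_star_def, simplified, rule_format, of "i + 1"]
      by (auto simp: add.assoc)
    then show ?thesis
      using int_ssm_step[of n w i] int_ssm_step[of n w "i + 1"]
      by (auto simp: flux_def short_def add.assoc split: if_splits)
  qed
  then show ?thesis by (simp add: X_star_def)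
qed

lemma ssm_step_X_star_even:
  assumes "n \<in> X_star_even"
  shows "ssm_step n w \<in> X_star_even"
proof -
  have X: "n \<in> X_star" using assms by (simp add: X_star_even_def)
  have odd_flux: "odd (flux n w k)" for k
    using X by (auto simp: X_star_def flux_def)
  have "even (ssm_step n w i)" for i
  proof -
    have "even (int (ssm_step n w i))"
      using assms odd_flux[of i] odd_flux[of "i - 1"]
      by (simp add: int_ssm_step X_star_even_def)
    then show ?thesis by simp
  qed
  then show ?thesis
    using ssm_step_X_star[OF X] by (simp add: X_star_even_def)
qed

definition coins :: "(int \<Rightarrow> bool) measure" where
  "coins = (\<Pi>\<^sub>M k\<in>UNIV. measure_pmf (bernoulli_pmf (1 / 2)))"

definition ssm_kernel :: "config \<Rightarrow> config measure" where
  "ssm_kernel n = distr coins borel (ssm_step n)"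

lemma measurable_config_iff:
  "f \<in> M \<rightarrow>\<^sub>M (borel :: config measure) \<longleftrightarrow> (\<forall>i. (\<lambda>x. f x i) \<in> M \<rightarrow>\<^sub>M count_space UNIV)"
proof -
  have "M \<rightarrow>\<^sub>M (borel :: config measure) = M \<rightarrow>\<^sub>M (\<Pi>\<^sub>M i\<in>UNIV. (borel :: nat measure))"
    by (rule measurable_cong_sets[OF refl sets_PiM_equal_borel[symmetric]])
  moreover have "f \<in> M \<rightarrow>\<^sub>M (\<Pi>\<^sub>M i\<in>UNIV. borel) \<longleftrightarrow> (\<forall>i. (\<lambda>x. f x i) \<in> M \<rightarrow>\<^sub>M borel)"
    by (auto simp: measurable_PiM_component_rev intro!: measurable_PiM_single')
  moreover have "M \<rightarrow>\<^sub>M (borel :: nat measure) = M \<rightarrow>\<^sub>M count_space UNIV"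
    by (rule measurable_cong_sets[OF refl sets_borel_eq_count_space])
  ultimately show ?thesis by simp
qed

lemma ssm_step_measurable:
  "(\<lambda>(n, w). ssm_step n w) \<in> borel \<Otimes>\<^sub>M coins \<rightarrow>\<^sub>M borel"
proof -
  have [measurable]: "(\<lambda>n :: config. n i) \<in> borel \<rightarrow>\<^sub>M count_space UNIV" for i
    using measurable_config_iff[of "\<lambda>n. n" borel] by simp
  have [measurable]: "(\<lambda>w. w i) \<in> coins \<rightarrow>\<^sub>M count_space UNIV" for i
    unfolding coins_def
    using measurable_component_singleton[of i UNIV "\<lambda>_. measure_pmf (bernoulli_pmf (1 / 2))"]
    by (simp cong: measurable_cong_sets)
  have pair: "(\<lambda>x. (f x, g x)) \<in> M \<rightarrow>\<^sub>M count_space UNIV"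
    if "f \<in> M \<rightarrow>\<^sub>M count_space UNIV" "g \<in> M \<rightarrow>\<^sub>M count_space UNIV"
    for M :: "(config \<times> (int \<Rightarrow> bool)) measure" and f :: "_ \<Rightarrow> 'a::countable" and g :: "_ \<Rightarrow> 'b::countable"
    using measurable_Pair[OF that] by (simp add: pair_measure_countable)
  define h :: "(nat \<times> nat \<times> nat) \<times> bool \<times> bool \<Rightarrow> nat" where
    "h = (\<lambda>((a, b, c), u, v). nat (int b +
       (if short a \<and> short b then 0 else if short a then - 1 else if short b then 1
        else if u then 1 else - 1) -
       (if short b \<and> short c then 0 else if short b then - 1 else if short c then 1
        else if v then 1 else - 1)))"
  have "ssm_step n w i = h ((n (i - 1), n i, n (i + 1)), w (i - 1), w i)" for n w i
    by (simp add: h_def ssm_step_def flux_def)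
  moreover have "(\<lambda>x. h ((fst x (i - 1), fst x i, fst x (i + 1)), snd x (i - 1), snd x i))
      \<in> borel \<Otimes>\<^sub>M coins \<rightarrow>\<^sub>M count_space UNIV" for i
    by (rule measurable_compose[of _ _ "count_space UNIV"], intro pair) measurable
  ultimately show ?thesis
    unfolding measurable_config_iff split_beta by simp
qed

lemma prob_space_coins: "prob_space coins"
  unfolding coins_def by (intro prob_space_PiM measure_pmf.prob_space_axioms)

lemma ssm_kernel_measurable: "ssm_kernel \<in> borel \<rightarrow>\<^sub>M prob_algebra borel"
proof (rule measurable_prob_algebraI)
  show "prob_space (ssm_kernel n)" for n
    unfolding ssm_kernel_def
    using ssm_step_measurable[THEN measurable_Pair_compose_split, of "\<lambda>_. n" coins "\<lambda>w. w"]
    by (intro prob_space.prob_space_distr prob_space_coins) auto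
  have "coins \<in> space (subprob_algebra coins)"
    using prob_space_coins
    by (simp add: space_subprob_algebra prob_space_imp_subprob_space)
  then show "ssm_kernel \<in> borel \<rightarrow>\<^sub>M subprob_algebra borel"
    unfolding ssm_kernel_def
    by (intro measurable_distr2[OF ssm_step_measurable] measurable_const)
qed


subsection \<open>States\<close>

text \<open>A Borel probability measure on a (measurable) subset \<open>A\<close> of the configuration space is
  identified with its extension by zero, a Borel probability measure on the whole space that is
  carried by \<open>A\<close>.\<close>

definition state_on :: "config set \<Rightarrow> config measure \<Rightarrow> bool" where
  "state_on A \<mu> \<longleftrightarrow> prob_space \<mu> \<and> sets \<mu> = sets borel \<and> (AE n in \<mu>. n \<in> A)"

definition shift :: "config \<Rightarrow> config" where
  "shift n = (\<lambda>i. n (i + 1))"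

definition translation_invariant :: "config measure \<Rightarrow> bool" where
  "translation_invariant \<mu> \<longleftrightarrow> distr \<mu> borel shift = \<mu>"

definition stationary :: "config measure \<Rightarrow> bool" where
  "stationary \<mu> \<longleftrightarrow> \<mu> \<bind> ssm_kernel = \<mu>"

definition TIS :: "config set \<Rightarrow> config measure set" where
  "TIS A = {\<mu>. state_on A \<mu> \<and> translation_invariant \<mu> \<and> stationary \<mu>}"

definition extremal_in :: "'a measure set \<Rightarrow> 'a measure \<Rightarrow> bool" where
  "extremal_in C \<mu> \<longleftrightarrow> \<mu> \<in> C \<and>
    (\<forall>\<nu>\<^sub>1\<in>C. \<forall>\<nu>\<^sub>2\<in>C. \<forall>p::real. 0 < p \<and> p < 1 \<and>
       (\<forall>B\<in>sets \<mu>. measure \<mu> B = p * measure \<nu>\<^sub>1 B + (1 - p) * measure \<nu>\<^sub>2 B)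
       \<longrightarrow> \<nu>\<^sub>1 = \<mu> \<and> \<nu>\<^sub>2 = \<mu>)"

definition ETIS :: "config set \<Rightarrow> config measure \<Rightarrow> bool" where
  "ETIS A \<mu> \<longleftrightarrow> extremal_in (TIS A) \<mu>"

definition has_density :: "config measure \<Rightarrow> real \<Rightarrow> bool" where
  "has_density \<mu> \<rho> \<longleftrightarrow> (AE n in \<mu>.
     (\<lambda>N. (\<Sum>i=1..int N. real (n i)) / real N) \<longlonglongrightarrow> \<rho> \<and>
     (\<lambda>N. (\<Sum>i=- int N..-1. real (n i)) / real N) \<longlonglongrightarrow> \<rho>)"

definition stationary_even :: "real \<Rightarrow> config measure set" where
  "stationary_even \<rho> = {\<mu>. state_on X_star_even \<mu> \<and> stationary \<mu> \<and> has_density \<mu> \<rho>}"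

definition ergodic :: "config measure \<Rightarrow> bool" where
  "ergodic \<mu> \<longleftrightarrow> translation_invariant \<mu> \<and>
    (\<forall>B\<in>sets borel. shift -` B = B \<longrightarrow> measure \<mu> B = 0 \<or> measure \<mu> B = 1)"


subsection \<open>Adding a zero-one configuration\<close>

definition gamma :: "config \<times> config \<Rightarrow> config" where
  "gamma = (\<lambda>(m, s) i. m i + s i)"

definition gamma_push :: "config measure \<Rightarrow> config measure \<Rightarrow> config measure" where
  "gamma_push \<mu> \<nu> = distr (\<mu> \<Otimes>\<^sub>M \<nu>) borel gamma"

end

theory Submission
  imports Defs
begin

text \<open>On \<^const>\<open>X_star\<close> every bond carries an odd flux, so the parity of each stack is conserved
  while the even part of the configuration evolves by the same dynamics on its own. Conditioned on
  any event of the parities, the even part is therefore stationary, hence translation invariant by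
  hypothesis; comparing with the joint translation invariance, the joint law of even part and
  parity is invariant under shifting the parity alone. If the parity law is ergodic, Birkhoff's
  theorem then makes every event of the parities independent of the even part, so the state is a
  product. Extremality of the product is transferred between the two sides through the even part,
  using that an invariant law dominated by an ergodic one coincides with it.\<close>

text \<open>Every single parity configuration may have probability zero, so conditioning is done on
  parity events of positive probability. Such a conditional law is stationary but a priori not
  translation invariant, and it is there that the hypothesis does its work. The converse meets an
  obstacle: a product of two extremal invariant laws may decompose under the diagonal shift, for
  instance when both have period two. Here every component of the product is itself TIS with the
  same ergodic parity law, hence again a product, and the decomposition descends to the even factor.
  On the ETIS side the parity law is ergodic because an invariant parity event of probability
  strictly between 0 and 1 would split the state into two conditional TIS states. Extremality in
  \<open>stationary_even\<close> compares only states of one density. A component of a mixture is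
  dominated by the mixture, and a density, being an almost sure property, is inherited under
  domination.\<close>

subsection \<open>Birkhoff's ergodic theorem for bounded functions\<close>

fun running_max :: "('a \<Rightarrow> 'a) \<Rightarrow> ('a \<Rightarrow> real) \<Rightarrow> nat \<Rightarrow> 'a \<Rightarrow> real" where
  "running_max T g 0 x = 0"
| "running_max T g (Suc n) x = max 0 (g x + running_max T g n (T x))"

text \<open>Unfolding the recursion gives Garsia's auxiliary function: the maximum over \<open>k \<le> n\<close> of the
  Birkhoff sums of length \<open>k\<close>, the empty sum included.\<close>

lemma running_max_nonneg: "0 \<le> running_max T g n x"
  by (cases n) auto

lemma running_max_mono_Suc: "running_max T g n x \<le> running_max T g (Suc n) x"
proof (induction n arbitrary: x)
  case (Suc n)
  from Suc[of "T x"] show ?case by auto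
qed auto

lemma birkhoff_sum_le_running_max:
  "k \<le> n \<Longrightarrow> (\<Sum>i<k. g ((T ^^ i) x)) \<le> running_max T g n x"
proof (induction n arbitrary: k x)
  case (Suc n)
  show ?case
  proof (cases k)
    case (Suc j)
    have "(\<Sum>i<k. g ((T ^^ i) x)) = g x + (\<Sum>i<j. g ((T ^^ i) (T x)))"
      unfolding Suc sum.lessThan_Suc_shift by (simp add: funpow_swap1)
    also have "\<dots> \<le> g x + running_max T g n (T x)"
      using Suc.IH[of j "T x"] Suc.prems Suc by simp
    finally show ?thesis by simp
  qed simp
qed simp

lemma running_max_bounded:
  assumes "\<And>x. \<bar>g x\<bar> \<le> C"
  shows "running_max T g n x \<le> real n * C"
proof (induction n arbitrary: x)
  case (Suc n)
  show ?case using Suc[of "T x"] assms[of x] running_max_nonneg[of T g n "T x"]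
    by (auto simp: algebra_simps)
qed simp

lemma running_max_measurable [measurable]:
  assumes [measurable]: "T \<in> M \<rightarrow>\<^sub>M M" "g \<in> borel_measurable M"
  shows "running_max T g n \<in> borel_measurable M"
proof (induction n)
  case (Suc n)
  note Suc[measurable]
  have "(\<lambda>x. max 0 (g x + running_max T g n (T x))) \<in> borel_measurable M"
    by measurable
  then show ?case by (simp cong: measurable_cong)
next
  case 0
  show ?case by (simp cong: measurable_cong)
qed

text \<open>Garsia's inequality. Where the left side is positive it equals \<open>g x\<close> plus
  the previous maximum at \<open>T x\<close>, which only grows with \<open>n\<close>; elsewhere it
  is 0 and the right side is nonnegative.\<close>

lemma running_max_le:
  "running_max T g n x \<le> indicator {x. 0 < running_max T g n x} x * g x + running_max T g n (T x)"
proof (cases n)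
  case (Suc m)
  then show ?thesis
    using running_max_mono_Suc[of T g m "T x"] running_max_nonneg[of T g n "T x"]
    by (auto simp: indicator_def max_def split: if_splits)
qed simp

lemma integral_measure_preserving:
  fixes f :: "'a \<Rightarrow> real"
  assumes "T \<in> M \<rightarrow>\<^sub>M M" "distr M M T = M" "f \<in> borel_measurable M"
  shows "(\<integral>x. f (T x) \<partial>M) = (\<integral>x. f x \<partial>M)"
  using integral_distr[of T M M f] assms by simp

text \<open>After integrating \<open>running_max_le\<close>, the two integrals of
  \<open>running_max\<close> cancel by invariance, so \<open>g\<close> has nonnegative integral over
  the set where the maximum is positive. By \<open>pos\<close> these sets exhaust the space up to a
  null set.\<close>

lemma maximal_ergodic:
  fixes g :: "'a \<Rightarrow> real"
  assumes M: "prob_space M" and T [measurable]: "T \<in> M \<rightarrow>\<^sub>M M" and pres: "distr M M T = M"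
    and g [measurable]: "g \<in> borel_measurable M" and bdd: "\<And>x. \<bar>g x\<bar> \<le> C"
    and pos: "AE x in M. \<exists>n. 0 < (\<Sum>i<n. g ((T ^^ i) x))"
  shows "0 \<le> (\<integral>x. g x \<partial>M)"
proof -
  interpret prob_space M by fact
  let ?h = "\<lambda>n x. indicator {x. 0 < running_max T g n x} x * g x"
  have C: "0 \<le> C" using bdd[of undefined] by linarith
  have h_int: "integrable M (?h n)" for n
    by (rule integrable_const_bound[of _ C]) (use bdd C in \<open>auto simp: indicator_def\<close>)
  have F_int: "integrable M (running_max T g n)" for n
    by (rule integrable_const_bound[of _ "real n * C"])
       (use running_max_bounded[of g C, OF bdd] running_max_nonneg[of T g n] in auto)
  have FT_int: "integrable M (\<lambda>x. running_max T g n (T x))" for n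
    by (rule integrable_const_bound[of _ "real n * C"])
       (use running_max_bounded[of g C, OF bdd] running_max_nonneg[of T g n] in auto)
  have h_nonneg: "0 \<le> (\<integral>x. ?h n x \<partial>M)" for n
  proof -
    have "(\<integral>x. running_max T g n x \<partial>M) \<le> (\<integral>x. ?h n x + running_max T g n (T x) \<partial>M)"
      by (intro integral_mono F_int Bochner_Integration.integrable_add h_int FT_int running_max_le)
    also have "\<dots> = (\<integral>x. ?h n x \<partial>M) + (\<integral>x. running_max T g n (T x) \<partial>M)"
      by (intro Bochner_Integration.integral_add h_int FT_int)
    also have "(\<integral>x. running_max T g n (T x) \<partial>M) = (\<integral>x. running_max T g n x \<partial>M)"
      by (rule integral_measure_preserving[OF T pres]) measurable
    finally show ?thesis by simp
  qed
  have "(\<lambda>n. \<integral>x. ?h n x \<partial>M) \<longlonglongrightarrow> (\<integral>x. g x \<partial>M)"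
  proof (rule integral_dominated_convergence[where w = "\<lambda>_. C"])
    show "AE x in M. (\<lambda>n. ?h n x) \<longlonglongrightarrow> g x"
      using pos
    proof eventually_elim
      case (elim x)
      then obtain k where k: "0 < (\<Sum>i<k. g ((T ^^ i) x))" by blast
      \<comment> \<open>One positive Birkhoff sum of length \<open>k\<close> keeps
        \<open>running_max\<close> positive for all \<open>n \<ge> k\<close>, so the indicator is
        eventually 1.\<close>
      have "eventually (\<lambda>n. ?h n x = g x) sequentially"
        using eventually_ge_at_top[of k]
      proof eventually_elim
        case (elim n)
        then show ?case
          using birkhoff_sum_le_running_max[OF elim, of g T x] k by (simp add: indicator_def)
      qed
      then show ?case by (rule tendsto_eventually)
    qed
    show "AE x in M. norm (?h n x) \<le> C" for n
      using bdd C by (auto simp: indicator_def)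
  qed simp_all
  then show ?thesis
    using h_nonneg by (intro LIMSEQ_le_const) auto
qed

section \<open>Pointwise convergence of Birkhoff averages\<close>

definition birkhoff_average :: "('a \<Rightarrow> 'a) \<Rightarrow> ('a \<Rightarrow> real) \<Rightarrow> nat \<Rightarrow> 'a \<Rightarrow> real" where
  "birkhoff_average T f n x = (\<Sum>i<n. f ((T ^^ i) x)) / real n"

lemma birkhoff_average_measurable [measurable]:
  assumes [measurable]: "T \<in> M \<rightarrow>\<^sub>M M" "f \<in> borel_measurable M"
  shows "birkhoff_average T f n \<in> borel_measurable M"
  unfolding birkhoff_average_def by measurable

text \<open>Starting at \<open>T x\<close> instead of \<open>x\<close> changes one summand at each
  end, and boundedness makes that vanish after division by \<open>n\<close>. The upper limit is used
  because convergence is not yet known.\<close>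

lemma limsup_birkhoff_average_invariant:
  assumes bdd: "\<And>x. \<bar>f x\<bar> \<le> C"
  shows "limsup (\<lambda>n. ereal (birkhoff_average T f n (T x))) =
    limsup (\<lambda>n. ereal (birkhoff_average T f n x))"
proof -
  let ?d = "\<lambda>n. (f ((T ^^ n) x) - f x) / real n"
  have split: "birkhoff_average T f n (T x) = ?d n + birkhoff_average T f n x" for n
  proof -
    have "f x + (\<Sum>i<n. f ((T ^^ i) (T x))) = (\<Sum>i<n. f ((T ^^ i) x)) + f ((T ^^ n) x)"
      using sum.lessThan_Suc_shift[of "\<lambda>i. f ((T ^^ i) x)" n] by (simp add: funpow_swap1)
    then have "(\<Sum>i<n. f ((T ^^ i) (T x))) = (f ((T ^^ n) x) - f x) + (\<Sum>i<n. f ((T ^^ i) x))"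
      by simp
    then show ?thesis
      by (simp add: birkhoff_average_def add_divide_distrib)
  qed
  have "?d \<longlonglongrightarrow> 0"
  proof (rule Lim_null_comparison)
    show "eventually (\<lambda>n. norm (?d n) \<le> 2 * C * inverse (real n)) sequentially"
    proof (intro always_eventually allI)
      fix n
      have "\<bar>f ((T ^^ n) x) - f x\<bar> \<le> 2 * C"
        using bdd[of "(T ^^ n) x"] bdd[of x] by linarith
      then show "norm (?d n) \<le> 2 * C * inverse (real n)"
        by (simp add: abs_mult divide_inverse mult_right_mono)
    qed
    show "(\<lambda>n. 2 * C * inverse (real n)) \<longlonglongrightarrow> 0"
      using tendsto_mult[OF tendsto_const lim_inverse_n, of "2 * C"] by simp
  qed
  then have "(\<lambda>n. ereal (?d n)) \<longlonglongrightarrow> ereal 0" by simp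
  from ereal_limsup_lim_add[OF this, of "\<lambda>n. ereal (birkhoff_average T f n x)"]
  show ?thesis by (simp add: split)
qed

text \<open>The set where the upper limit exceeds a level is invariant, hence trivial. Were it of
  full measure for a level \<open>c\<close> above the mean, \<open>maximal_ergodic\<close> for
  \<open>f - c\<close> would force the mean to be at least \<open>c\<close>.\<close>

lemma birkhoff_upper:
  fixes f :: "'a \<Rightarrow> real"
  assumes M: "prob_space M" and T [measurable]: "T \<in> M \<rightarrow>\<^sub>M M" and pres: "distr M M T = M"
    and erg: "\<And>B. B \<in> sets M \<Longrightarrow> T -` B \<inter> space M = B \<Longrightarrow> measure M B = 0 \<or> measure M B = 1"
    and f [measurable]: "f \<in> borel_measurable M" and bdd: "\<And>x. \<bar>f x\<bar> \<le> C"
    and b: "(\<integral>x. f x \<partial>M) < b"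
  shows "AE x in M. eventually (\<lambda>n. birkhoff_average T f n x < b) sequentially"
proof -
  interpret prob_space M by fact
  \<comment> \<open>An intermediate level: an upper limit at most \<open>c\<close> is strictly below
    \<open>b\<close>, which yields the eventual strict bound.\<close>
  obtain c where c: "(\<integral>x. f x \<partial>M) < c" "c < b" using dense[OF b] by blast
  define B where "B = {x \<in> space M. limsup (\<lambda>n. ereal (birkhoff_average T f n x)) > ereal c}"
  have B [measurable]: "B \<in> sets M"
    unfolding B_def by measurable
  have "T -` B \<inter> space M = B"
    using limsup_birkhoff_average_invariant[of f C T, OF bdd] measurable_space[OF T]
    by (auto simp: B_def)
  from erg[OF B this] have "prob B = 0"
  proof
    assume "prob B = 1"
    then have "AE x in M. x \<in> B" by (simp add: prob_eq_1)
    then have "AE x in M. \<exists>n. 0 < (\<Sum>i<n. f ((T ^^ i) x) - c)"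
    proof eventually_elim
      case (elim x)
      \<comment> \<open>The witness must be positive: at \<open>n = 0\<close> division by zero makes
        the average 0, which exceeds a negative \<open>c\<close> although the sum is empty.\<close>
      have "\<exists>n>0. c < birkhoff_average T f n x"
      proof (rule ccontr)
        assume "\<not> ?thesis"
        then have "birkhoff_average T f n x \<le> c" if "0 < n" for n
          using that by (meson not_less)
        then have "eventually (\<lambda>n. ereal (birkhoff_average T f n x) \<le> ereal c) sequentially"
          by (intro eventually_mono[OF eventually_gt_at_top[of "0 :: nat"]]) simp
        from Limsup_bounded[OF this] show False using elim by (simp add: B_def flip: not_le)
      qed
      then show ?case
        by (auto simp: birkhoff_average_def sum_subtractf field_simps)
    qed
    from maximal_ergodic[OF M T pres, of "\<lambda>x. f x - c" "C + \<bar>c\<bar>", OF _ _ this]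
    have "0 \<le> (\<integral>x. f x - c \<partial>M)"
      using bdd by (force intro: order_trans[OF abs_triangle_ineq4] add_mono)
    moreover have "integrable M f"
      by (rule integrable_const_bound[of _ C]) (use bdd in auto)
    ultimately show ?thesis using c by (simp add: prob_space)
  qed
  then have "AE x in M. x \<notin> B" by (simp add: prob_eq_0)
  then show ?thesis using AE_space
  proof eventually_elim
    case (elim x)
    then have "limsup (\<lambda>n. ereal (birkhoff_average T f n x)) < ereal b"
      using c by (auto simp: B_def not_less intro: le_less_trans)
    from Limsup_lessD[OF this] show ?case by simp
  qed
qed

text \<open>The one-sided bound for \<open>f\<close> and for \<open>- f\<close>, with margins
  \<open>inverse (real (Suc k))\<close> so that only countably many null sets are discarded.\<close>

lemma birkhoff:
  fixes f :: "'a \<Rightarrow> real"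
  assumes M: "prob_space M" and T [measurable]: "T \<in> M \<rightarrow>\<^sub>M M" and pres: "distr M M T = M"
    and erg: "\<And>B. B \<in> sets M \<Longrightarrow> T -` B \<inter> space M = B \<Longrightarrow> measure M B = 0 \<or> measure M B = 1"
    and f [measurable]: "f \<in> borel_measurable M" and bdd: "\<And>x. \<bar>f x\<bar> \<le> C"
  shows "AE x in M. (\<lambda>n. birkhoff_average T f n x) \<longlonglongrightarrow> (\<integral>x. f x \<partial>M)"
proof -
  let ?I = "\<integral>x. f x \<partial>M"
  have up: "AE x in M. \<forall>k. eventually (\<lambda>n. birkhoff_average T f n x < ?I + inverse (real (Suc k))) sequentially"
    unfolding AE_all_countable
    by (intro allI birkhoff_upper[OF M T pres erg f bdd]) auto
  have neg: "birkhoff_average T (\<lambda>x. - f x) n x = - birkhoff_average T f n x" for n x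
    by (simp add: birkhoff_average_def sum_negf)
  have low: "AE x in M. \<forall>k. eventually (\<lambda>n. birkhoff_average T (\<lambda>x. - f x) n x < - ?I + inverse (real (Suc k))) sequentially"
    unfolding AE_all_countable
    by (intro allI birkhoff_upper[OF M T pres erg, where C = C]) (use bdd in auto)
  show ?thesis using up low
  proof eventually_elim
    case (elim x)
    show ?case
    proof (rule tendstoI)
      fix e :: real assume "0 < e"
      then obtain k where k: "inverse (real (Suc k)) < e" using reals_Archimedean by blast
      show "eventually (\<lambda>n. dist (birkhoff_average T f n x) ?I < e) sequentially"
        using elim(1)[rule_format, of k] elim(2)[rule_format, of k]
        by eventually_elim (use k in \<open>auto simp: neg dist_real_def\<close>)
    qed
  qed
qed

text \<open>By domination the averages of the indicator of \<open>B\<close> converge to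
  \<open>measure M B\<close> also almost everywhere under \<open>N\<close>. By invariance each
  average of positive length has \<open>N\<close>-integral \<open>measure N B\<close>, and dominated
  convergence compares the two. \<open>N\<close> carries arbitrary finite mass so that the
  restriction of a law to an event is covered.\<close>

lemma ergodic_absolutely_continuous:
  assumes M: "prob_space M" and T [measurable]: "T \<in> M \<rightarrow>\<^sub>M M" and pres: "distr M M T = M"
    and erg: "\<And>B. B \<in> sets M \<Longrightarrow> T -` B \<inter> space M = B \<Longrightarrow> measure M B = 0 \<or> measure M B = 1"
    and N: "finite_measure N" and sets_N [measurable_cong]: "sets N = sets M"
    and ac: "absolutely_continuous M N"
    and inv: "\<And>B. B \<in> sets M \<Longrightarrow> measure N (T -` B \<inter> space M) = measure N B"
    and B [measurable]: "B \<in> sets M"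
  shows "measure N B = measure M B * measure N (space M)"
proof -
  interpret M: prob_space M by fact
  interpret N: finite_measure N by fact
  have space_N [simp]: "space N = space M" by (rule sets_eq_imp_space_eq[OF sets_N])
  have bdd: "\<bar>indicator B x :: real\<bar> \<le> 1" for x by (simp add: indicator_def)
  have M_avg: "AE x in M. (\<lambda>n. birkhoff_average T (indicator B) n x) \<longlonglongrightarrow> measure M B"
    using birkhoff[OF M T pres erg, of "indicator B" 1] bdd by simp
  have avg: "AE x in N. (\<lambda>n. birkhoff_average T (indicator B) n x) \<longlonglongrightarrow> measure M B"
    by (rule absolutely_continuous_AE[OF sets_N ac M_avg])
  have int_pow: "(\<integral>x. indicat_real B ((T ^^ i) x) \<partial>N) = measure N B" for i
  proof -
    have meas [measurable]: "(T ^^ i) \<in> M \<rightarrow>\<^sub>M M" for i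
      by (rule measurable_compose_n[OF T])
    have "measure N ((T ^^ i) -` B \<inter> space M) = measure N B"
    proof (induction i)
      case (Suc i)
      have "(T ^^ Suc i) -` B \<inter> space M = T -` ((T ^^ i) -` B \<inter> space M) \<inter> space M"
        using measurable_space[OF T] by (auto simp: funpow_swap1)
      moreover have "(T ^^ i) -` B \<inter> space M \<in> sets M" by measurable
      ultimately show ?case by (simp only: inv Suc)
    next
      case 0
      show ?case using sets.sets_into_space[OF B] by (simp add: Int_absorb2)
    qed
    moreover have "(\<integral>x. indicat_real B ((T ^^ i) x) \<partial>N) = (\<integral>x. indicat_real ((T ^^ i) -` B \<inter> space M) x \<partial>N)"
      by (rule Bochner_Integration.integral_cong) (auto simp: indicator_def)
    ultimately show ?thesis by (simp add: Int_absorb2)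
  qed
  have int: "integrable N (\<lambda>x. indicator B ((T ^^ i) x) :: real)" for i
  proof -
    have [measurable]: "(T ^^ i) \<in> M \<rightarrow>\<^sub>M M"
      by (rule measurable_compose_n[OF T])
    show ?thesis
      by (rule N.integrable_const_bound[of _ 1]) (auto simp: indicator_def)
  qed
  have eq: "(\<integral>x. birkhoff_average T (indicator B) n x \<partial>N) = measure N B" if "0 < n" for n
    using that int by (simp add: birkhoff_average_def int_pow)
  have avg_meas [measurable]: "birkhoff_average T (indicator B) n \<in> borel_measurable N" for n
  proof -
    have "birkhoff_average T (indicator B) n \<in> borel_measurable M" by measurable
    then show ?thesis by (simp cong: measurable_cong_sets add: sets_N)
  qed
  have "(\<lambda>n. \<integral>x. birkhoff_average T (indicator B) n x \<partial>N) \<longlonglongrightarrow> (\<integral>x. measure M B \<partial>N)"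
  proof (rule integral_dominated_convergence[where w = "\<lambda>_. 1"])
    show "AE x in N. norm (birkhoff_average T (indicator B) n x) \<le> 1" for n
    proof (rule AE_I2)
      fix x
      have "(\<Sum>i<n. indicator B ((T ^^ i) x) :: real) \<le> (\<Sum>i<n. 1)"
        by (rule sum_mono) (simp add: indicator_def)
      then have "(\<Sum>i<n. indicator B ((T ^^ i) x) :: real) \<le> real n" by simp
      moreover have "0 \<le> (\<Sum>i<n. indicator B ((T ^^ i) x) :: real)"
        by (rule sum_nonneg) simp
      ultimately show "norm (birkhoff_average T (indicator B) n x) \<le> 1"
        by (cases "n = 0") (simp_all add: birkhoff_average_def)
    qed
  qed (use avg in simp_all)
  moreover have "(\<lambda>n. \<integral>x. birkhoff_average T (indicator B) n x \<partial>N) \<longlonglongrightarrow> measure N B"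
    by (intro tendsto_eventually eventually_mono[OF eventually_gt_at_top[of 0]] eq)
  ultimately have "measure N B = (\<integral>x. measure M B \<partial>N)"
    by (rule LIMSEQ_unique[rotated])
  then show ?thesis by (simp add: mult.commute)
qed

subsection \<open>Even part and parity\<close>

text \<open>Restricted to \<open>X_star_even\<close> and \<open>S_bin\<close>, \<open>gamma\<close>
  is a bijection onto \<open>X_star\<close>; \<open>even_part\<close> and \<open>parity\<close> are
  the coordinates of its inverse.\<close>

definition even_part :: "config \<Rightarrow> config" where
  "even_part n = (\<lambda>i. 2 * (n i div 2))"

definition parity :: "config \<Rightarrow> config" where
  "parity n = (\<lambda>i. n i mod 2)"

lemma measurable_component [measurable]: "(\<lambda>n :: config. n i) \<in> borel \<rightarrow>\<^sub>M count_space UNIV"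
  using measurable_config_iff[of "\<lambda>n. n" borel] by simp

lemma measurable_even_part [measurable]: "even_part \<in> borel \<rightarrow>\<^sub>M borel"
  unfolding measurable_config_iff even_part_def by measurable

lemma measurable_parity [measurable]: "parity \<in> borel \<rightarrow>\<^sub>M borel"
  unfolding measurable_config_iff parity_def by measurable

lemma measurable_shift [measurable]: "shift \<in> borel \<rightarrow>\<^sub>M borel"
  unfolding measurable_config_iff shift_def by measurable

lemma measurable_gamma [measurable]: "gamma \<in> borel \<Otimes>\<^sub>M borel \<rightarrow>\<^sub>M borel"
proof -
  have "(\<lambda>x. gamma x i) \<in> (borel \<Otimes>\<^sub>M borel :: (config \<times> config) measure) \<rightarrow>\<^sub>M count_space UNIV" for i
  proof -
    have "(\<lambda>x. (fst x i, snd x i)) \<in> (borel \<Otimes>\<^sub>M borel :: (config \<times> config) measure)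
        \<rightarrow>\<^sub>M count_space UNIV \<Otimes>\<^sub>M count_space UNIV"
      by measurable
    then have "(\<lambda>x. (\<lambda>(a, b). a + b) (fst x i, snd x i)) \<in> (borel \<Otimes>\<^sub>M borel :: (config \<times> config) measure)
        \<rightarrow>\<^sub>M count_space UNIV"
      by (rule measurable_compose) (simp add: pair_measure_countable)
    then show ?thesis by (simp add: gamma_def split_beta)
  qed
  then show ?thesis by (simp add: measurable_config_iff)
qed

lemma measurable_ssm_step [measurable]: "ssm_step n \<in> coins \<rightarrow>\<^sub>M borel"
  using ssm_step_measurable[THEN measurable_Pair_compose_split, of "\<lambda>_. n" coins "\<lambda>w. w"] by simp

lemma X_star_measurable [measurable]: "X_star \<in> sets borel"
proof -
  have "{n \<in> space borel. \<forall>i. \<not> (n i \<le> Suc 0 \<and> n (i + 1) \<le> Suc 0)} \<in> sets (borel :: config measure)"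
    by measurable
  then show ?thesis by (simp add: X_star_def short_def)
qed

lemma X_star_even_measurable [measurable]: "X_star_even \<in> sets borel"
proof -
  have "{n \<in> space borel. n \<in> X_star \<and> (\<forall>i. even (n i))} \<in> sets (borel :: config measure)"
    by measurable
  then show ?thesis by (simp add: X_star_even_def)
qed

lemma S_bin_measurable [measurable]: "S_bin \<in> sets borel"
proof -
  have "{n \<in> space borel. \<forall>i. n i \<in> {0, 1}} \<in> sets (borel :: config measure)"
    by measurable
  then show ?thesis by (simp add: S_bin_def)
qed

lemma gamma_even_part_parity [simp]: "gamma (even_part n, parity n) = n"
  by (simp add: gamma_def even_part_def parity_def)

lemma even_part_gamma: "m \<in> X_star_even \<Longrightarrow> s \<in> S_bin \<Longrightarrow> even_part (gamma (m, s)) = m"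
  and parity_gamma: "m \<in> X_star_even \<Longrightarrow> s \<in> S_bin \<Longrightarrow> parity (gamma (m, s)) = s"
proof -
  have "2 * ((m i + s i) div 2) = m i \<and> (m i + s i) mod 2 = s i"
    if "m \<in> X_star_even" "s \<in> S_bin" for i
  proof -
    have "even (m i)" "s i < 2" using that by (auto simp: X_star_even_def S_bin_def dest: spec[of _ i])
    then show ?thesis by presburger
  qed
  then show "m \<in> X_star_even \<Longrightarrow> s \<in> S_bin \<Longrightarrow> even_part (gamma (m, s)) = m"
    "m \<in> X_star_even \<Longrightarrow> s \<in> S_bin \<Longrightarrow> parity (gamma (m, s)) = s"
    by (auto simp: gamma_def even_part_def parity_def)
qed

lemma parity_in_S_bin [simp]: "parity n \<in> S_bin"
  by (auto simp: parity_def S_bin_def)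

text \<open>A stack is short exactly when its quotient by 2 is zero, so the threshold 1 cannot see
  the parity bit. This is what decouples the even part from the parity.\<close>

lemma short_even_part [simp]: "short (even_part n i) = short (n i)"
  unfolding even_part_def short_def by presburger

lemma even_part_in_X_star_even: "n \<in> X_star \<Longrightarrow> even_part n \<in> X_star_even"
  by (auto simp: X_star_even_def X_star_def) (simp add: even_part_def)

lemma gamma_in_X_star: "m \<in> X_star_even \<Longrightarrow> s \<in> S_bin \<Longrightarrow> gamma (m, s) \<in> X_star"
proof -
  assume m: "m \<in> X_star_even" and s: "s \<in> S_bin"
  have "short (gamma (m, s) i) = short (m i)" for i
    using short_even_part[of "gamma (m, s)" i] by (simp add: even_part_gamma[OF m s])
  then show ?thesis using m by (simp add: X_star_even_def X_star_def)
qed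

lemma even_part_shift: "even_part (shift n) = shift (even_part n)"
  and parity_shift: "parity (shift n) = shift (parity n)"
  and gamma_shift: "gamma (shift m, shift s) = shift (gamma (m, s))"
  by (simp_all add: even_part_def parity_def gamma_def shift_def)

section \<open>Conservation of parity and autonomy of the even part\<close>

lemma flux_even_part: "flux (even_part n) w = flux n w"
  by (simp add: flux_def fun_eq_iff)

text \<open>Two adjacent short stacks are the only case of zero flux, and \<open>X_star\<close>
  excludes it. A site thus changes by a difference of two odd numbers.\<close>

lemma flux_odd: "n \<in> X_star \<Longrightarrow> odd (flux n w k)"
  by (auto simp: X_star_def flux_def)

lemma parity_ssm_step:
  assumes "n \<in> X_star"
  shows "parity (ssm_step n w) = parity n"
proof
  fix i
  have "even (int (ssm_step n w i)) \<longleftrightarrow> even (int (n i))"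
    using flux_odd[OF assms, of w "i - 1"] flux_odd[OF assms, of w i]
    by (simp add: int_ssm_step)
  then show "parity (ssm_step n w) i = parity n i"
    by (simp add: parity_def mod2_eq_if)
qed

text \<open>The fluxes of \<open>n\<close> and of its even part agree for the same coins, and the
  parity that is subtracted does not move.\<close>

lemma even_part_ssm_step:
  assumes "n \<in> X_star"
  shows "even_part (ssm_step n w) = ssm_step (even_part n) w"
proof
  fix i
  have part: "int (even_part n i) = int (n i) - int (parity n i)" for n i
    by (simp add: even_part_def parity_def minus_mod_eq_mult_div flip: of_nat_diff)
  have "int (even_part (ssm_step n w) i) = int (ssm_step (even_part n) w i)"
    unfolding part int_ssm_step flux_even_part parity_ssm_step[OF assms] by simp
  then show "even_part (ssm_step n w) i = ssm_step (even_part n) w i" by simp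
qed

lemma ssm_step_gamma:
  assumes "m \<in> X_star_even" "s \<in> S_bin"
  shows "ssm_step (gamma (m, s)) w = gamma (ssm_step m w, s)"
  using gamma_even_part_parity[of "ssm_step (gamma (m, s)) w"] gamma_in_X_star[OF assms]
  by (simp add: even_part_ssm_step parity_ssm_step even_part_gamma parity_gamma assms)

section \<open>The transition kernel on even parts and parities\<close>

lemma emeasure_ssm_kernel:
  "A \<in> sets borel \<Longrightarrow> emeasure (ssm_kernel n) A = emeasure coins {w \<in> space coins. ssm_step n w \<in> A}"
  unfolding ssm_kernel_def
  by (subst emeasure_distr) (auto intro!: arg_cong[where f = "emeasure coins"])

lemma emeasure_ssm_kernel_even_part:
  assumes n: "n \<in> X_star" and [measurable]: "A \<in> sets borel"
  shows "emeasure (ssm_kernel (even_part n)) A = emeasure (ssm_kernel n) (even_part -` A)"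
proof -
  have [measurable]: "even_part -` A \<in> sets borel"
    using measurable_sets[OF measurable_even_part, of A] by simp
  show ?thesis by (simp add: emeasure_ssm_kernel even_part_ssm_step[OF n])
qed

text \<open>Almost surely in the coins the parity stays put, so a parity event is a deterministic
  factor. Conditioning on it therefore commutes with the dynamics.\<close>

lemma emeasure_ssm_kernel_parity:
  assumes n: "n \<in> X_star" and [measurable]: "A \<in> sets borel" "B \<in> sets borel"
  shows "emeasure (ssm_kernel n) (parity -` B \<inter> A) =
    indicator (parity -` B) n * emeasure (ssm_kernel n) A"
proof -
  have [measurable]: "parity -` B \<in> sets borel"
    using measurable_sets[OF measurable_parity, of B] by simp
  show ?thesis by (simp add: emeasure_ssm_kernel parity_ssm_step[OF n] indicator_def)
qed

lemma emeasure_ssm_kernel_gamma: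
  assumes ms: "m \<in> X_star_even" "s \<in> S_bin" and [measurable]: "A \<in> sets borel"
  shows "emeasure (ssm_kernel (gamma (m, s))) A = emeasure (ssm_kernel m) {m. gamma (m, s) \<in> A}"
proof -
  have "{m \<in> space borel. gamma (m, s) \<in> A} \<in> sets borel" by measurable
  then show ?thesis by (simp add: emeasure_ssm_kernel ssm_step_gamma[OF ms])
qed

lemma measurable_emeasure_ssm_kernel [measurable]:
  assumes "A \<in> sets borel"
  shows "(\<lambda>n. emeasure (ssm_kernel n) A) \<in> borel_measurable borel"
  using measurable_compose[OF measurable_prob_algebraD[OF ssm_kernel_measurable]
      measurable_emeasure_subprob_algebra[OF assms]] .

section \<open>Stationarity under projection and conditioning\<close>

lemma stationary_iff:
  assumes "state_on A \<mu>"
  shows "stationary \<mu> \<longleftrightarrow>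
    (\<forall>B\<in>sets borel. (\<integral>\<^sup>+ n. emeasure (ssm_kernel n) B \<partial>\<mu>) = emeasure \<mu> B)"
proof -
  interpret prob_space \<mu> using assms by (simp add: state_on_def)
  have sets: "sets \<mu> = sets borel" using assms by (simp add: state_on_def)
  have K: "ssm_kernel \<in> \<mu> \<rightarrow>\<^sub>M subprob_algebra borel"
    using measurable_prob_algebraD[OF ssm_kernel_measurable]
    by (simp add: measurable_cong_sets[OF sets refl])
  have "emeasure (\<mu> \<bind> ssm_kernel) B = (\<integral>\<^sup>+ n. emeasure (ssm_kernel n) B \<partial>\<mu>)"
    if "B \<in> sets borel" for B
    by (rule emeasure_bind[OF not_empty K that])
  moreover have "sets (\<mu> \<bind> ssm_kernel) = sets borel"
    by (rule sets_bind[OF _ not_empty]) (simp add: ssm_kernel_def)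
  ultimately show ?thesis
    unfolding stationary_def using sets
    by (auto intro!: measure_eqI)
qed

lemma state_on_distr:
  assumes "state_on A \<mu>" and [measurable]: "f \<in> borel \<rightarrow>\<^sub>M borel" "B \<in> sets borel"
    and "\<And>n. n \<in> A \<Longrightarrow> f n \<in> B"
  shows "state_on B (distr \<mu> borel f)"
proof -
  interpret prob_space \<mu> using assms by (simp add: state_on_def)
  have sets [measurable_cong]: "sets \<mu> = sets borel" using assms by (simp add: state_on_def)
  have "AE n in \<mu>. n \<in> A" using assms by (simp add: state_on_def)
  then have "AE n in \<mu>. f n \<in> B" by eventually_elim (rule assms(4))
  then have "AE n in distr \<mu> borel f. n \<in> B" by (subst AE_distr_iff) auto
  moreover have "prob_space (distr \<mu> borel f)" by (rule prob_space_distr) simp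
  ultimately show ?thesis by (simp add: state_on_def)
qed

lemma vimage_parity_measurable [measurable]: "B \<in> sets borel \<Longrightarrow> parity -` B \<in> sets borel"
  using measurable_sets[OF measurable_parity, of B] by simp

lemma vimage_even_part_measurable [measurable]: "B \<in> sets borel \<Longrightarrow> even_part -` B \<in> sets borel"
  using measurable_sets[OF measurable_even_part, of B] by simp

lemma vimage_shift_measurable [measurable]: "B \<in> sets borel \<Longrightarrow> shift -` B \<in> sets borel"
  using measurable_sets[OF measurable_shift, of B] by simp

lemma stationary_distr_even_part:
  assumes \<mu>: "state_on X_star \<mu>" and stat: "stationary \<mu>"
  shows "stationary (distr \<mu> borel even_part)"
proof -
  have sets [measurable_cong]: "sets \<mu> = sets borel" using \<mu> by (simp add: state_on_def)
  have "state_on X_star_even (distr \<mu> borel even_part)"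
    by (rule state_on_distr[OF \<mu>]) (simp_all add: even_part_in_X_star_even)
  moreover have "(\<integral>\<^sup>+ n. emeasure (ssm_kernel n) B \<partial>distr \<mu> borel even_part) =
      emeasure (distr \<mu> borel even_part) B" if [measurable]: "B \<in> sets borel" for B
  proof -
    have "(\<integral>\<^sup>+ n. emeasure (ssm_kernel n) B \<partial>distr \<mu> borel even_part) =
        (\<integral>\<^sup>+ n. emeasure (ssm_kernel (even_part n)) B \<partial>\<mu>)"
      by (rule nn_integral_distr) simp_all
    also have "\<dots> = (\<integral>\<^sup>+ n. emeasure (ssm_kernel n) (even_part -` B) \<partial>\<mu>)"
    proof (rule nn_integral_cong_AE)
      have "AE n in \<mu>. n \<in> X_star" using \<mu> by (simp add: state_on_def)
      then show "AE n in \<mu>. emeasure (ssm_kernel (even_part n)) B = emeasure (ssm_kernel n) (even_part -` B)"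
        by eventually_elim (rule emeasure_ssm_kernel_even_part[OF _ that])
    qed
    also have "\<dots> = emeasure \<mu> (even_part -` B)"
      using stat unfolding stationary_iff[OF \<mu>] by simp
    also have "\<dots> = emeasure (distr \<mu> borel even_part) B"
      by (subst emeasure_distr) (auto simp: sets_eq_imp_space_eq[OF sets])
    finally show ?thesis .
  qed
  ultimately show ?thesis by (subst stationary_iff) auto
qed

text \<open>A parity event is neither entered nor left, so its indicator passes through the kernel
  and the normalisation is the same before and after a step. As \<open>B\<close> is an arbitrary
  Borel set, the conditional law need not inherit translation invariance.\<close>

lemma
  assumes \<mu>: "state_on X_star \<mu>" and B [measurable]: "B \<in> sets borel"
    and pos: "measure \<mu> (parity -` B) \<noteq> 0"
  shows state_on_condition_parity: "state_on X_star (uniform_measure \<mu> (parity -` B))"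
    and stationary_condition_parity: "stationary \<mu> \<Longrightarrow> stationary (uniform_measure \<mu> (parity -` B))"
proof -
  interpret prob_space \<mu> using \<mu> by (simp add: state_on_def)
  let ?C = "parity -` B" and ?\<mu>' = "uniform_measure \<mu> (parity -` B)"
  have sets [measurable_cong]: "sets \<mu> = sets borel" using \<mu> by (simp add: state_on_def)
  have pos': "emeasure \<mu> ?C \<noteq> 0" using pos by (simp add: emeasure_eq_measure)
  have C [measurable]: "?C \<in> sets \<mu>" by measurable
  have "AE n in ?\<mu>'. n \<in> X_star"
    by (rule AE_uniform_measureI[OF C]) (use \<mu> in \<open>auto simp: state_on_def\<close>)
  moreover have "prob_space ?\<mu>'"
    by (rule prob_space_uniform_measure[OF pos']) simp
  ultimately show state: "state_on X_star ?\<mu>'"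
    by (simp add: state_on_def sets)
  assume stat: "stationary \<mu>"
  have "(\<integral>\<^sup>+ n. emeasure (ssm_kernel n) A \<partial>?\<mu>') = emeasure ?\<mu>' A" if A [measurable]: "A \<in> sets borel" for A
  proof -
    have "(\<integral>\<^sup>+ n. emeasure (ssm_kernel n) A \<partial>?\<mu>') =
        (\<integral>\<^sup>+ n. emeasure (ssm_kernel n) A * indicator ?C n \<partial>\<mu>) / emeasure \<mu> ?C"
      by (rule nn_integral_uniform_measure) measurable
    also have "(\<integral>\<^sup>+ n. emeasure (ssm_kernel n) A * indicator ?C n \<partial>\<mu>) =
        (\<integral>\<^sup>+ n. emeasure (ssm_kernel n) (?C \<inter> A) \<partial>\<mu>)"
    proof (rule nn_integral_cong_AE)
      have "AE n in \<mu>. n \<in> X_star" using \<mu> by (simp add: state_on_def)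
      then show "AE n in \<mu>. emeasure (ssm_kernel n) A * indicator ?C n = emeasure (ssm_kernel n) (?C \<inter> A)"
        by eventually_elim (simp only: emeasure_ssm_kernel_parity[OF _ A B] mult.commute)
    qed
    also have "\<dots> = emeasure \<mu> (?C \<inter> A)"
      using stat unfolding stationary_iff[OF \<mu>] by simp
    also have "\<dots> / emeasure \<mu> ?C = emeasure ?\<mu>' A"
      by (rule emeasure_uniform_measure[symmetric]) measurable
    finally show ?thesis .
  qed
  then show "stationary ?\<mu>'" by (subst stationary_iff[OF state]) auto
qed

section \<open>Translation invariance\<close>

lemma translation_invariant_measure:
  assumes "translation_invariant \<mu>" and sets [measurable_cong]: "sets \<mu> = sets borel"
    and [measurable]: "B \<in> sets borel"
  shows "measure \<mu> (shift -` B) = measure \<mu> B"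
proof -
  have "measure \<mu> B = measure (distr \<mu> borel shift) B"
    using assms(1) by (simp add: translation_invariant_def)
  also have "\<dots> = measure \<mu> (shift -` B)"
    by (subst measure_distr) (auto simp: sets_eq_imp_space_eq[OF sets])
  finally show ?thesis ..
qed

lemma translation_invariantI:
  assumes "state_on A \<mu>"
    and "\<And>B. B \<in> sets borel \<Longrightarrow> measure \<mu> (shift -` B) = measure \<mu> B"
  shows "translation_invariant \<mu>"
proof -
  interpret prob_space \<mu> using assms by (simp add: state_on_def)
  have sets [measurable_cong]: "sets \<mu> = sets borel" using assms by (simp add: state_on_def)
  have "emeasure (distr \<mu> borel shift) B = emeasure \<mu> B" if [measurable]: "B \<in> sets borel" for B
    using assms(2)[OF that]
    by (subst emeasure_distr) (auto simp: sets_eq_imp_space_eq[OF sets] emeasure_eq_measure)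
  then show ?thesis
    unfolding translation_invariant_def by (intro measure_eqI) (simp_all add: sets)
qed

lemma translation_invariant_distr:
  assumes ti: "translation_invariant \<mu>" and [measurable_cong]: "sets \<mu> = sets borel"
    and [measurable]: "f \<in> borel \<rightarrow>\<^sub>M borel" and comm: "\<And>n. f (shift n) = shift (f n)"
  shows "translation_invariant (distr \<mu> borel f)"
proof -
  have "distr (distr \<mu> borel f) borel shift = distr \<mu> borel (\<lambda>n. shift (f n))"
    by (subst distr_distr) (auto simp: comp_def)
  also have "\<dots> = distr (distr \<mu> borel shift) borel f"
    by (subst distr_distr) (auto simp: comp_def comm)
  finally show ?thesis using ti by (simp add: translation_invariant_def)
qed

text \<open>Conditioning on the conserved parity yields a stationary state on
  \<^const>\<open>X_star_even\<close>, which is translation invariant by hypothesis. Shifting the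
  even part back by one therefore costs nothing, so the joint law may be shifted in the parity alone.\<close>

lemma joint_law_shift_parity:
  assumes all_ti: "\<And>\<eta>. state_on X_star_even \<eta> \<Longrightarrow> stationary \<eta> \<Longrightarrow> translation_invariant \<eta>"
    and \<mu>: "\<mu> \<in> TIS X_star" and A [measurable]: "A \<in> sets borel" and B [measurable]: "B \<in> sets borel"
  shows "measure \<mu> (even_part -` A \<inter> parity -` (shift -` B)) = measure \<mu> (even_part -` A \<inter> parity -` B)"
proof -
  have state: "state_on X_star \<mu>" and ti: "translation_invariant \<mu>" and stat: "stationary \<mu>"
    using \<mu> by (simp_all add: TIS_def)
  interpret prob_space \<mu> using state by (simp add: state_on_def)
  have sets [measurable_cong]: "sets \<mu> = sets borel" using state by (simp add: state_on_def)
  have space [simp]: "space \<mu> = UNIV" using sets_eq_imp_space_eq[OF sets] by simp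
  let ?C = "parity -` (shift -` B)"
  have C: "?C \<in> sets \<mu>" by measurable
  have "?C = shift -` (parity -` B)" by (auto simp: parity_shift)
  then have C_eq: "prob ?C = prob (parity -` B)"
    using translation_invariant_measure[OF ti sets, of "parity -` B"] by simp
  show ?thesis
  proof (cases "prob ?C = 0")
    \<comment> \<open>A null event cannot be conditioned on; by \<open>C_eq\<close> both parity
      events are null and both sides vanish.\<close>
    case True
    have "prob (even_part -` A \<inter> ?C) \<le> prob ?C" "prob (even_part -` A \<inter> parity -` B) \<le> prob (parity -` B)"
      by (intro finite_measure_mono; measurable; auto)+
    then show ?thesis using True C_eq measure_nonneg[of \<mu>] by (metis antisym)
  next
    case False
    let ?\<eta> = "distr (uniform_measure \<mu> ?C) borel even_part"
    note cond = state_on_condition_parity[OF state _ False]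
      stationary_condition_parity[OF state _ False stat]
    have \<eta>: "state_on X_star_even ?\<eta>"
      by (rule state_on_distr[OF cond(1)]) (simp_all add: even_part_in_X_star_even)
    have "stationary ?\<eta>"
      by (rule stationary_distr_even_part[OF cond]) simp_all
    from all_ti[OF \<eta> this] have "translation_invariant ?\<eta>" .
    from translation_invariant_measure[OF this _ A]
    have "measure ?\<eta> (shift -` A) = measure ?\<eta> A" by simp
    moreover have "measure ?\<eta> D = prob (even_part -` D \<inter> ?C) / prob ?C"
      if [measurable]: "D \<in> sets borel" for D
    proof -
      have "measure ?\<eta> D = measure (uniform_measure \<mu> ?C) (even_part -` D)"
        by (subst measure_distr) auto
      also have "\<dots> = prob (?C \<inter> even_part -` D) / prob ?C"
        by (subst measure_uniform_measure)
           (use False C in \<open>auto simp: emeasure_eq_measure\<close>)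
      finally show ?thesis by (simp add: Int_commute)
    qed
    ultimately have "prob (even_part -` (shift -` A) \<inter> ?C) = prob (even_part -` A \<inter> ?C)"
      using False by simp
    \<comment> \<open>With a shift in both coordinates the event is the shift preimage of the
      unshifted one, so joint invariance removes both shifts at once.\<close>
    moreover have "even_part -` (shift -` A) \<inter> ?C = shift -` (even_part -` A \<inter> parity -` B)"
      by (auto simp: parity_shift even_part_shift)
    ultimately show ?thesis
      using translation_invariant_measure[OF ti sets, of "even_part -` A \<inter> parity -` B"] by simp
  qed
qed

lemma state_on_S_bin_distr_parity:
  "state_on X_star \<mu> \<Longrightarrow> state_on S_bin (distr \<mu> borel parity)"
  by (rule state_on_distr[where A = X_star]) simp_all

lemma state_on_X_star_even_distr_even_part:
  "state_on X_star \<mu> \<Longrightarrow> state_on X_star_even (distr \<mu> borel even_part)"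
  by (rule state_on_distr[where A = X_star]) (simp_all add: even_part_in_X_star_even)

section \<open>Independence of even part and parity\<close>

lemma distr_shift_eq:
  assumes "translation_invariant \<nu>" "sets \<nu> = sets borel"
  shows "distr \<nu> \<nu> shift = \<nu>"
  using assms(1) distr_cong[OF refl assms(2) refl, of \<nu> shift] by (simp only: translation_invariant_def)

lemma ergodic_absolutely_continuous_shift:
  assumes \<nu>: "state_on S \<nu>" "ergodic \<nu>" and N: "finite_measure N" and sets_N: "sets N = sets borel"
    and ac: "absolutely_continuous \<nu> N"
    and inv: "\<And>B. B \<in> sets borel \<Longrightarrow> measure N (shift -` B) = measure N B"
    and B: "B \<in> sets borel"
  shows "measure N B = measure \<nu> B * measure N UNIV"
proof -
  have sets: "sets \<nu> = sets borel" and prob: "prob_space \<nu>" using \<nu> by (simp_all add: state_on_def)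
  have space: "space \<nu> = UNIV" using sets_eq_imp_space_eq[OF sets] by simp
  have "measure N B = measure \<nu> B * measure N (space \<nu>)"
  proof (rule ergodic_absolutely_continuous[OF prob _ distr_shift_eq[OF _ sets] _ N _ ac])
    show "shift \<in> \<nu> \<rightarrow>\<^sub>M \<nu>"
      using measurable_shift by (simp add: measurable_cong_sets[OF sets sets])
    show "translation_invariant \<nu>" using \<nu>(2) by (simp add: ergodic_def)
    show "measure \<nu> B = 0 \<or> measure \<nu> B = 1" if "B \<in> sets \<nu>" "shift -` B \<inter> space \<nu> = B" for B
      using \<nu>(2) that by (simp add: ergodic_def sets space)
    show "measure N (shift -` B \<inter> space \<nu>) = measure N B" if "B \<in> sets \<nu>" for B
      using inv that by (simp add: sets space)
  qed (simp_all add: sets sets_N B)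
  then show ?thesis by (simp add: space)
qed

lemma TIS_product:
  assumes all_ti: "\<And>\<eta>. state_on X_star_even \<eta> \<Longrightarrow> stationary \<eta> \<Longrightarrow> translation_invariant \<eta>"
    and \<mu>: "\<mu> \<in> TIS X_star" and erg: "ergodic (distr \<mu> borel parity)"
  shows "\<mu> = gamma_push (distr \<mu> borel even_part) (distr \<mu> borel parity)"
proof -
  have state: "state_on X_star \<mu>" using \<mu> by (simp add: TIS_def)
  interpret prob_space \<mu> using state by (simp add: state_on_def)
  have sets [measurable_cong]: "sets \<mu> = sets borel" using state by (simp add: state_on_def)
  have space [simp]: "space \<mu> = UNIV" using sets_eq_imp_space_eq[OF sets] by simp
  let ?e = "distr \<mu> borel even_part" and ?l = "distr \<mu> borel parity"
  interpret e: prob_space ?e by (rule prob_space_distr) simp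
  interpret l: prob_space ?l by (rule prob_space_distr) simp
  have indep: "prob (even_part -` A \<inter> parity -` B) = prob (even_part -` A) * prob (parity -` B)"
    if A [measurable]: "A \<in> sets borel" and B [measurable]: "B \<in> sets borel" for A B
  proof -
    \<comment> \<open>\<open>?N\<close> is the law of the parity restricted to the event that the
      even part lies in \<open>A\<close>. It is dominated by \<open>?l\<close> and, by
      \<open>joint_law_shift_parity\<close>, shift invariant, hence a multiple of the ergodic
      \<open>?l\<close>; the factor is the probability of that event. This is independence.\<close>
    let ?r = "density \<mu> (indicator (even_part -` A))"
    let ?N = "distr ?r borel parity"
    have N: "emeasure ?N D = emeasure \<mu> (even_part -` A \<inter> parity -` D)" if [measurable]: "D \<in> sets borel" for D
      by (subst emeasure_distr)
         (auto simp: emeasure_density simp flip: indicator_inter_arith intro!: nn_integral_indicator)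
    have N': "measure ?N D = prob (even_part -` A \<inter> parity -` D)" if "D \<in> sets borel" for D
      using N[OF that] by (simp add: measure_def)
    have "finite_measure ?N"
      by (rule finite_measureI) (simp add: N)
    moreover have "absolutely_continuous ?l ?N"
      unfolding absolutely_continuous_def
    proof
      fix D assume "D \<in> null_sets ?l"
      then have [measurable]: "D \<in> sets borel" and "emeasure ?l D = 0" by (auto simp: null_sets_def)
      then have "emeasure \<mu> (parity -` D) = 0" by (simp add: emeasure_distr)
      moreover have "emeasure \<mu> (even_part -` A \<inter> parity -` D) \<le> emeasure \<mu> (parity -` D)"
        by (rule emeasure_mono) auto
      ultimately have "emeasure ?N D = 0" by (simp add: N)
      then show "D \<in> null_sets ?N" by (simp add: null_sets_def)
    qed
    ultimately have "measure ?N B = measure ?l B * measure ?N UNIV"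
      using joint_law_shift_parity[OF all_ti \<mu> A]
      by (intro ergodic_absolutely_continuous_shift[OF state_on_S_bin_distr_parity[OF state] erg])
         (auto simp: N')
    moreover have "measure ?l B = prob (parity -` B)"
      by (simp add: measure_distr)
    ultimately show ?thesis by (simp add: N' mult.commute del: measure_distr)
  qed
  have "distr \<mu> (borel \<Otimes>\<^sub>M borel) (\<lambda>n. (even_part n, parity n)) = ?e \<Otimes>\<^sub>M ?l" (is "?J = _")
  proof (rule pair_measure_eqI[symmetric])
    show "emeasure ?e A * emeasure ?l B = emeasure ?J (A \<times> B)" if "A \<in> sets ?e" "B \<in> sets ?l" for A B
    proof -
      have [measurable]: "A \<in> sets borel" "B \<in> sets borel" using that by simp_all
      have "(\<lambda>n. (even_part n, parity n)) -` (A \<times> B) \<inter> space \<mu> = even_part -` A \<inter> parity -` B" by auto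
      then show ?thesis
        by (simp add: emeasure_distr emeasure_eq_measure indep ennreal_mult)
    qed
  next
    show "sets (?e \<Otimes>\<^sub>M ?l) = sets ?J"
      by (simp cong: sets_pair_measure_cong)
  qed unfold_locales
  then have "gamma_push ?e ?l = distr ?J borel gamma" by (simp add: gamma_push_def)
  also have "\<dots> = distr \<mu> borel (gamma \<circ> (\<lambda>n. (even_part n, parity n)))"
    by (rule distr_distr) measurable
  also have "\<dots> = distr \<mu> borel (\<lambda>n. n)"
    by (simp only: comp_def gamma_even_part_parity)
  also have "\<dots> = \<mu>" by (rule distr_id2) (simp add: sets)
  finally show ?thesis ..
qed

subsection \<open>Product states\<close>

lemma sets_gamma_push [simp, measurable_cong]: "sets (gamma_push \<nu> l) = sets borel"
  and space_gamma_push [simp]: "space (gamma_push \<nu> l) = UNIV"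
  by (simp_all add: gamma_push_def)

text \<open>Everything is computed by sections at a fixed parity configuration \<open>s\<close>:
  there \<open>gamma\<close> intertwines the dynamics of \<open>m\<close> with that of the sum, so
  stationarity holds section by section. Recovering both marginals makes \<open>gamma_push\<close>
  injective in each factor.\<close>

lemma
  assumes \<nu>: "state_on X_star_even \<nu>" and l: "state_on S_bin l"
  shows measure_gamma_push: "A \<in> sets borel \<Longrightarrow>
      measure (gamma_push \<nu> l) A = (\<integral> s. measure \<nu> {m. gamma (m, s) \<in> A} \<partial>l)"
    and integrable_gamma_push_section:
      "A \<in> sets borel \<Longrightarrow> integrable l (\<lambda>s. measure \<nu> {m. gamma (m, s) \<in> A})"
    and state_on_gamma_push: "state_on X_star (gamma_push \<nu> l)"
    and stationary_gamma_push: "stationary \<nu> \<Longrightarrow> stationary (gamma_push \<nu> l)"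
    and translation_invariant_gamma_push: "translation_invariant \<nu> \<Longrightarrow> translation_invariant l \<Longrightarrow>
      translation_invariant (gamma_push \<nu> l)"
    and distr_even_part_gamma_push: "distr (gamma_push \<nu> l) borel even_part = \<nu>"
    and distr_parity_gamma_push: "distr (gamma_push \<nu> l) borel parity = l"
proof -
  interpret n: prob_space \<nu> using \<nu> by (simp add: state_on_def)
  interpret l: prob_space l using l by (simp add: state_on_def)
  interpret pair_prob_space \<nu> l ..
  have sets [measurable_cong]: "sets \<nu> = sets borel" "sets l = sets borel"
    using \<nu> l by (simp_all add: state_on_def)
  have space [simp]: "space \<nu> = UNIV" "space l = UNIV"
    using sets_eq_imp_space_eq[OF sets(1)] sets_eq_imp_space_eq[OF sets(2)] by simp_all
  have sets_pair: "sets (\<nu> \<Otimes>\<^sub>M l) = sets (borel \<Otimes>\<^sub>M borel)"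
    by (rule sets_pair_measure_cong[OF sets])
  have [measurable]: "gamma \<in> \<nu> \<Otimes>\<^sub>M l \<rightarrow>\<^sub>M borel"
    using measurable_gamma by (simp add: measurable_cong_sets[OF sets_pair refl])
  have em: "emeasure (gamma_push \<nu> l) A = (\<integral>\<^sup>+ s. emeasure \<nu> {m. gamma (m, s) \<in> A} \<partial>l)"
    if [measurable]: "A \<in> sets borel" for A
  proof -
    have "emeasure (gamma_push \<nu> l) A = emeasure (\<nu> \<Otimes>\<^sub>M l) (gamma -` A \<inter> space (\<nu> \<Otimes>\<^sub>M l))"
      unfolding gamma_push_def by (rule emeasure_distr) measurable
    also have "\<dots> = (\<integral>\<^sup>+ s. emeasure \<nu> ((\<lambda>m. (m, s)) -` (gamma -` A \<inter> space (\<nu> \<Otimes>\<^sub>M l))) \<partial>l)"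
      by (rule emeasure_pair_measure_alt2) measurable
    also have "\<dots> = (\<integral>\<^sup>+ s. emeasure \<nu> {m. gamma (m, s) \<in> A} \<partial>l)"
      by (simp add: space_pair_measure vimage_def)
    finally show ?thesis .
  qed
  have section_meas: "(\<lambda>s. emeasure \<nu> {m. gamma (m, s) \<in> A}) \<in> borel_measurable l"
    if [measurable]: "A \<in> sets borel" for A
  proof -
    have "gamma -` A \<inter> space (\<nu> \<Otimes>\<^sub>M l) \<in> sets (\<nu> \<Otimes>\<^sub>M l)" by measurable
    from measurable_emeasure_Pair2[OF this] show ?thesis
      by (simp add: space_pair_measure vimage_def)
  qed
  show int: "integrable l (\<lambda>s. measure \<nu> {m. gamma (m, s) \<in> A})" if "A \<in> sets borel" for A
  proof (rule l.integrable_const_bound[of _ 1])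
    show "(\<lambda>s. measure \<nu> {m. gamma (m, s) \<in> A}) \<in> borel_measurable l"
      unfolding measure_def using section_meas[OF that] by measurable
  qed simp
  show "measure (gamma_push \<nu> l) A = (\<integral> s. measure \<nu> {m. gamma (m, s) \<in> A} \<partial>l)"
    if "A \<in> sets borel" for A
  proof -
    have "emeasure (gamma_push \<nu> l) A = ennreal (\<integral> s. measure \<nu> {m. gamma (m, s) \<in> A} \<partial>l)"
      unfolding em[OF that] n.emeasure_eq_measure
      by (rule nn_integral_eq_integral[OF int[OF that]]) simp
    then show ?thesis by (simp add: measure_def integral_nonneg_AE)
  qed
  have AE_m: "AE m in \<nu>. m \<in> X_star_even" and AE_s: "AE s in l. s \<in> S_bin"
    using \<nu> l by (simp_all add: state_on_def)
  have AE_pair: "AE x in \<nu> \<Otimes>\<^sub>M l. fst x \<in> X_star_even \<and> snd x \<in> S_bin"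
  proof (rule AE_pair_measure)
    show "{x \<in> space (\<nu> \<Otimes>\<^sub>M l). fst x \<in> X_star_even \<and> snd x \<in> S_bin} \<in> sets (\<nu> \<Otimes>\<^sub>M l)"
      by measurable
    show "AE m in \<nu>. AE s in l. fst (m, s) \<in> X_star_even \<and> snd (m, s) \<in> S_bin"
      using AE_m
    proof eventually_elim
      case (elim m)
      show ?case using AE_s by eventually_elim (simp add: elim)
    qed
  qed
  have prob: "prob_space (gamma_push \<nu> l)"
    unfolding gamma_push_def by (rule P.prob_space_distr) measurable
  have "AE n in gamma_push \<nu> l. n \<in> X_star"
    unfolding gamma_push_def
  proof (subst AE_distr_iff)
    show "AE x in \<nu> \<Otimes>\<^sub>M l. gamma x \<in> X_star"
      using AE_pair by eventually_elim (auto intro: gamma_in_X_star)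
  qed simp_all
  then show state: "state_on X_star (gamma_push \<nu> l)"
    using prob by (simp add: state_on_def)
  show "stationary (gamma_push \<nu> l)" if stat: "stationary \<nu>"
  proof (subst stationary_iff[OF state], rule)
    fix A :: "config set" assume A [measurable]: "A \<in> sets borel"
    have "(\<integral>\<^sup>+ n. emeasure (ssm_kernel n) A \<partial>gamma_push \<nu> l) =
        (\<integral>\<^sup>+ x. emeasure (ssm_kernel (gamma x)) A \<partial>(\<nu> \<Otimes>\<^sub>M l))"
      unfolding gamma_push_def by (rule nn_integral_distr) measurable
    \<comment> \<open>The even part is integrated first, so that stationarity of
      \<open>\<nu>\<close> can be applied with \<open>s\<close> frozen.\<close>
    also have "\<dots> = (\<integral>\<^sup>+ s. \<integral>\<^sup>+ m. emeasure (ssm_kernel (gamma (m, s))) A \<partial>\<nu> \<partial>l)"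
      by (rule nn_integral_snd[symmetric]) measurable
    also have "\<dots> = (\<integral>\<^sup>+ s. emeasure \<nu> {m. gamma (m, s) \<in> A} \<partial>l)"
    proof (rule nn_integral_cong_AE)
      show "AE s in l. (\<integral>\<^sup>+ m. emeasure (ssm_kernel (gamma (m, s))) A \<partial>\<nu>) =
          emeasure \<nu> {m. gamma (m, s) \<in> A}"
        using AE_s
      proof eventually_elim
        case (elim s)
        have "{m \<in> space borel. gamma (m, s) \<in> A} \<in> sets borel" by measurable
        then have sec: "{m. gamma (m, s) \<in> A} \<in> sets borel" by simp
        have "(\<integral>\<^sup>+ m. emeasure (ssm_kernel (gamma (m, s))) A \<partial>\<nu>) =
            (\<integral>\<^sup>+ m. emeasure (ssm_kernel m) {m. gamma (m, s) \<in> A} \<partial>\<nu>)"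
        proof (rule nn_integral_cong_AE)
          show "AE m in \<nu>. emeasure (ssm_kernel (gamma (m, s))) A =
              emeasure (ssm_kernel m) {m. gamma (m, s) \<in> A}"
            using AE_m by eventually_elim (rule emeasure_ssm_kernel_gamma[OF _ elim A])
        qed
        also have "\<dots> = emeasure \<nu> {m. gamma (m, s) \<in> A}"
          using stat sec unfolding stationary_iff[OF \<nu>] by blast
        finally show ?case .
      qed
    qed
    also have "\<dots> = emeasure (gamma_push \<nu> l) A" by (rule em[OF A, symmetric])
    finally show "(\<integral>\<^sup>+ n. emeasure (ssm_kernel n) A \<partial>gamma_push \<nu> l) = emeasure (gamma_push \<nu> l) A" .
  qed
  show "translation_invariant (gamma_push \<nu> l)"
    if ti: "translation_invariant \<nu>" "translation_invariant l"
  proof -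
    have gs: "(\<lambda>(m, s). (shift m, shift s)) \<in> \<nu> \<Otimes>\<^sub>M l \<rightarrow>\<^sub>M borel \<Otimes>\<^sub>M borel"
      by measurable
    have \<nu>l: "distr \<nu> borel shift = \<nu>" "distr l borel shift = l"
      using ti by (simp_all add: translation_invariant_def)
    have "distr \<nu> borel shift \<Otimes>\<^sub>M distr l borel shift =
        distr (\<nu> \<Otimes>\<^sub>M l) (borel \<Otimes>\<^sub>M borel) (\<lambda>(m, s). (shift m, shift s))"
      by (rule pair_measure_distr) (simp_all add: \<nu>l l.sigma_finite_measure_axioms)
    then have eq: "\<nu> \<Otimes>\<^sub>M l = distr (\<nu> \<Otimes>\<^sub>M l) (borel \<Otimes>\<^sub>M borel) (\<lambda>(m, s). (shift m, shift s))"
      by (simp only: \<nu>l)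
    have "distr (gamma_push \<nu> l) borel shift = distr (\<nu> \<Otimes>\<^sub>M l) borel (shift \<circ> gamma)"
      unfolding gamma_push_def by (rule distr_distr) measurable
    also have "shift \<circ> gamma = gamma \<circ> (\<lambda>(m, s). (shift m, shift s))"
      by (auto simp: gamma_shift)
    also have "distr (\<nu> \<Otimes>\<^sub>M l) borel \<dots> =
        distr (distr (\<nu> \<Otimes>\<^sub>M l) (borel \<Otimes>\<^sub>M borel) (\<lambda>(m, s). (shift m, shift s))) borel gamma"
      by (rule distr_distr[OF measurable_gamma gs, symmetric])
    also have "\<dots> = gamma_push \<nu> l"
      unfolding eq[symmetric] gamma_push_def ..
    finally show ?thesis by (simp only: translation_invariant_def)
  qed
  show "distr (gamma_push \<nu> l) borel even_part = \<nu>"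
  proof (rule measure_eqI)
    fix A assume "A \<in> sets (distr (gamma_push \<nu> l) borel even_part)"
    then have A [measurable]: "A \<in> sets borel" by simp
    have "emeasure (distr (gamma_push \<nu> l) borel even_part) A = emeasure (gamma_push \<nu> l) (even_part -` A)"
      by (subst emeasure_distr) simp_all
    also have "\<dots> = (\<integral>\<^sup>+ s. emeasure \<nu> {m. gamma (m, s) \<in> even_part -` A} \<partial>l)"
      by (rule em) simp
    also have "\<dots> = (\<integral>\<^sup>+ s. emeasure \<nu> A \<partial>l)"
    proof (rule nn_integral_cong_AE)
      show "AE s in l. emeasure \<nu> {m. gamma (m, s) \<in> even_part -` A} = emeasure \<nu> A"
        using AE_s
      proof eventually_elim
        case (elim s)
        have "{m \<in> space borel. gamma (m, s) \<in> even_part -` A} \<in> sets borel" by measurable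
        then show ?case
          using AE_m by (intro emeasure_eq_AE) (auto simp: sets even_part_gamma[OF _ elim] elim: eventually_mono)
      qed
    qed
    finally show "emeasure (distr (gamma_push \<nu> l) borel even_part) A = emeasure \<nu> A"
      by (simp add: l.emeasure_space_1[simplified])
  qed (simp add: sets)
  show "distr (gamma_push \<nu> l) borel parity = l"
  proof (rule measure_eqI)
    fix A assume "A \<in> sets (distr (gamma_push \<nu> l) borel parity)"
    then have A [measurable]: "A \<in> sets borel" by simp
    have "emeasure (distr (gamma_push \<nu> l) borel parity) A = emeasure (gamma_push \<nu> l) (parity -` A)"
      by (subst emeasure_distr) simp_all
    also have "\<dots> = (\<integral>\<^sup>+ s. emeasure \<nu> {m. gamma (m, s) \<in> parity -` A} \<partial>l)"
      by (rule em) simp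
    also have "\<dots> = (\<integral>\<^sup>+ s. indicator A s \<partial>l)"
    proof (rule nn_integral_cong_AE)
      show "AE s in l. emeasure \<nu> {m. gamma (m, s) \<in> parity -` A} = indicator A s"
        using AE_s
      proof eventually_elim
        case (elim s)
        have "{m \<in> space borel. gamma (m, s) \<in> parity -` A} \<in> sets borel" by measurable
        then have "emeasure \<nu> {m. gamma (m, s) \<in> parity -` A} = emeasure \<nu> {m. s \<in> A}"
          using AE_m by (intro emeasure_eq_AE) (auto simp: sets parity_gamma[OF _ elim] elim: eventually_mono)
        then show ?case by (simp add: n.emeasure_space_1[simplified] indicator_def)
      qed
    qed
    finally show "emeasure (distr (gamma_push \<nu> l) borel parity) A = emeasure l A"
      by (simp add: sets)
  qed (simp add: sets)
qed

subsection \<open>Densities\<close>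

text \<open>The inverse of \<open>shift\<close>; the left half of a density is a Birkhoff average
  along it.\<close>

definition unshift :: "config \<Rightarrow> config" where
  "unshift n = (\<lambda>i. n (i - 1))"

lemma measurable_unshift [measurable]: "unshift \<in> borel \<rightarrow>\<^sub>M borel"
  unfolding measurable_config_iff unshift_def by measurable

lemma unshift_shift [simp]: "unshift (shift n) = n" and shift_unshift [simp]: "shift (unshift n) = n"
  by (simp_all add: shift_def unshift_def)

lemma funpow_shift: "(shift ^^ k) n = (\<lambda>i. n (i + int k))"
  by (induction k arbitrary: n) (simp_all add: shift_def fun_eq_iff algebra_simps)

lemma funpow_unshift: "(unshift ^^ k) n = (\<lambda>i. n (i - int k))"
  by (induction k arbitrary: n) (simp_all add: unshift_def fun_eq_iff algebra_simps)

lemma ergodic_birkhoff_shift: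
  assumes l: "state_on S l" and erg: "ergodic l"
    and f [measurable]: "f \<in> borel_measurable borel" and bdd: "\<And>x. \<bar>f x\<bar> \<le> (C :: real)"
  shows "AE s in l. (\<lambda>n. birkhoff_average shift f n s) \<longlonglongrightarrow> (\<integral>s. f s \<partial>l)"
    and "AE s in l. (\<lambda>n. birkhoff_average unshift f n s) \<longlonglongrightarrow> (\<integral>s. f s \<partial>l)"
proof -
  have sets: "sets l = sets borel" and prob: "prob_space l" using l by (simp_all add: state_on_def)
  have space: "space l = UNIV" using sets_eq_imp_space_eq[OF sets] by simp
  have ti: "translation_invariant l" using erg by (simp add: ergodic_def)
  have f': "f \<in> borel_measurable l" using f by (simp add: measurable_cong_sets[OF sets refl])
  have shift: "shift \<in> l \<rightarrow>\<^sub>M l" and unshift: "unshift \<in> l \<rightarrow>\<^sub>M l"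
    using measurable_shift measurable_unshift by (simp_all add: measurable_cong_sets[OF sets sets])
  have pres: "distr l l shift = l" by (rule distr_shift_eq[OF ti sets])
  have "distr l l unshift = distr (distr l l shift) l unshift" by (simp only: pres)
  also have "\<dots> = distr l l (unshift \<circ> shift)" by (rule distr_distr[OF unshift shift])
  also have "\<dots> = distr l l (\<lambda>n. n)" by (simp add: comp_def)
  also have "\<dots> = l" by (rule distr_id2) simp
  finally have pres': "distr l l unshift = l" .
  have zero_one: "measure l B = 0 \<or> measure l B = 1" if "B \<in> sets l" "shift -` B \<inter> space l = B" for B
    using erg that by (simp add: ergodic_def sets space)
  \<comment> \<open>A set invariant under the inverse is invariant under \<open>shift\<close>
    itself, so ergodicity carries over.\<close>
  have zero_one': "measure l B = 0 \<or> measure l B = 1" if "B \<in> sets l" "unshift -` B \<inter> space l = B" for B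
  proof -
    have "shift -` B = shift -` (unshift -` B)" using that(2) space by simp
    also have "\<dots> = B" by auto
    finally show ?thesis using zero_one[OF that(1)] space by simp
  qed
  show "AE s in l. (\<lambda>n. birkhoff_average shift f n s) \<longlonglongrightarrow> (\<integral>s. f s \<partial>l)"
    by (rule birkhoff[OF prob shift pres zero_one f' bdd])
  show "AE s in l. (\<lambda>n. birkhoff_average unshift f n s) \<longlonglongrightarrow> (\<integral>s. f s \<partial>l)"
    by (rule birkhoff[OF prob unshift pres' zero_one' f' bdd])
qed

lemma sum_positive_int: "(\<Sum>i=1..int N. f i) = (\<Sum>i<N. f (1 + int i))"
proof (induction N)
  case (Suc N)
  have "{1..int (Suc N)} = insert (1 + int N) {1..int N}" by auto
  then show ?case using Suc by (simp add: add.commute)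
qed simp

lemma sum_negative_int: "(\<Sum>i=- int N..-1. f i) = (\<Sum>i<N. f (- 1 - int i))"
proof (induction N)
  case (Suc N)
  have "{- int (Suc N)..-1} = insert (- 1 - int N) {- int N..-1}" by auto
  then show ?case using Suc by (simp add: add.commute)
qed simp

text \<open>Birkhoff's theorem is run along \<open>shift\<close> from site 1 and along
  \<open>unshift\<close> from site -1, the first sites of the two sums in
  \<open>has_density\<close>. The density is the probability that a site is occupied.\<close>

lemma ergodic_has_density:
  assumes l: "state_on S_bin l" and erg: "ergodic l"
  obtains \<kappa> where "has_density l \<kappa>"
proof
  interpret prob_space l using l by (simp add: state_on_def)
  have sets [measurable_cong]: "sets l = sets borel" using l by (simp_all add: state_on_def)
  have space [simp]: "space l = UNIV" using sets_eq_imp_space_eq[OF sets] by simp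
  \<comment> \<open>The height \<open>s j\<close> is unbounded on the whole configuration space;
    this indicator is bounded and agrees with it on \<open>S_bin\<close>.\<close>
  let ?f = "\<lambda>j s. indicat_real {s :: config. s j = 1} s"
  have occ [measurable]: "{s :: config. s j = 1} \<in> sets borel" for j
  proof -
    have "{s \<in> space borel. s j = 1} \<in> sets (borel :: config measure)" by measurable
    then show ?thesis by simp
  qed
  have ti: "translation_invariant l" using erg by (simp add: ergodic_def)
  have step: "measure l {s. s (j + 1) = 1} = measure l {s. s j = 1}" for j
    using translation_invariant_measure[OF ti sets occ[of j]] by (simp add: shift_def vimage_def)
  \<comment> \<open>Two unit shifts lead from site -1 to site 1, so the left and right limits
    coincide.\<close>
  have "measure l {s. s (-1) = 1} = measure l {s. s 1 = 1}"
    using step[of "-1"] step[of 0] by simp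
  then have \<kappa>: "(\<integral>s. ?f (-1) s \<partial>l) = measure l {s. s 1 = 1}" "(\<integral>s. ?f 1 s \<partial>l) = measure l {s. s 1 = 1}"
    by simp_all
  have bdd: "\<bar>?f j s\<bar> \<le> 1" for j s by (simp add: indicator_def)
  have "AE s in l. s \<in> S_bin" using l by (simp add: state_on_def)
  moreover have "AE s in l. (\<lambda>n. birkhoff_average shift (?f 1) n s) \<longlonglongrightarrow> (\<integral>s. ?f 1 s \<partial>l)"
    by (rule ergodic_birkhoff_shift(1)[OF l erg _ bdd]) measurable
  moreover have "AE s in l. (\<lambda>n. birkhoff_average unshift (?f (-1)) n s) \<longlonglongrightarrow> (\<integral>s. ?f (-1) s \<partial>l)"
    by (rule ergodic_birkhoff_shift(2)[OF l erg _ bdd]) measurable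
  ultimately show "has_density l (measure l {s. s 1 = 1})"
    unfolding has_density_def \<kappa>
  proof eventually_elim
    case (elim s)
    have "real (s i) = indicat_real {t. t i = 1} s" for i
      using elim(1) by (auto simp: S_bin_def indicator_def dest: spec[of _ i])
    then show ?case
      using elim(2,3)
      by (simp add: sum_positive_int sum_negative_int birkhoff_average_def funpow_shift funpow_unshift
          indicator_def)
  qed
qed

text \<open>Convergence is rewritten as a condition on the lower and upper limits, which are
  measurable. Transporting a density through \<open>distr\<close> needs this measurability.\<close>

lemma measurable_tendsto_const:
  fixes f :: "nat \<Rightarrow> 'a \<Rightarrow> real"
  assumes [measurable]: "\<And>n. f n \<in> borel_measurable M"
  shows "{x \<in> space M. (\<lambda>n. f n x) \<longlonglongrightarrow> c} \<in> sets M"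
proof -
  have "(\<lambda>n. f n x) \<longlonglongrightarrow> c \<longleftrightarrow>
      liminf (\<lambda>n. ereal (f n x)) = ereal c \<and> limsup (\<lambda>n. ereal (f n x)) = ereal c" for x
    using tendsto_iff_Liminf_eq_Limsup[of sequentially "\<lambda>n. ereal (f n x)" "ereal c"] by simp
  then show ?thesis by simp
qed

lemma has_density_distr_even_part:
  assumes sets [measurable_cong]: "sets \<mu> = sets borel"
    and \<mu>: "has_density \<mu> \<rho>" and par: "has_density (distr \<mu> borel parity) \<kappa>"
  shows "has_density (distr \<mu> borel even_part) (\<rho> - \<kappa>)"
proof -
  let ?P = "\<lambda>\<rho> n. (\<lambda>N. (\<Sum>i=1..int N. real (n i)) / real N) \<longlonglongrightarrow> \<rho> \<and>
     (\<lambda>N. (\<Sum>i=- int N..-1. real (n i)) / real N) \<longlonglongrightarrow> \<rho>"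
  have meas: "{n \<in> space borel. ?P \<rho> n} \<in> sets (borel :: config measure)" for \<rho>
    by (intro sets.sets_Collect_conj measurable_tendsto_const) measurable
  have "AE n in \<mu>. ?P \<kappa> (parity n)"
    by (rule AE_distrD[OF _ par[unfolded has_density_def]]) measurable
  with \<mu>[unfolded has_density_def] have "AE n in \<mu>. ?P (\<rho> - \<kappa>) (even_part n)"
  proof eventually_elim
    case (elim n)
    have "real (even_part n i) = real (n i) - real (parity n i)" for i
      by (simp add: even_part_def parity_def minus_mod_eq_mult_div flip: of_nat_diff)
    then show ?case
      using elim tendsto_diff[of _ \<rho> sequentially _ \<kappa>]
      by (simp add: sum_subtractf diff_divide_distrib)
  qed
  then show ?thesis
    unfolding has_density_def using meas by (subst AE_distr_iff) simp_all
qed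

subsection \<open>Extremality\<close>

lemma absolutely_continuous_distr:
  assumes "absolutely_continuous M N" and sets: "sets N = sets M" and f: "f \<in> M \<rightarrow>\<^sub>M L"
  shows "absolutely_continuous (distr M L f) (distr N L f)"
proof -
  have f': "f \<in> N \<rightarrow>\<^sub>M L" using f by (simp add: measurable_cong_sets[OF sets refl])
  have "space N = space M" by (rule sets_eq_imp_space_eq[OF sets])
  then show ?thesis
    using assms(1) f f' by (auto simp: absolutely_continuous_def null_sets_distr_iff)
qed

text \<open>Because \<open>B\<close> is shift invariant and \<open>parity\<close> commutes with
  \<open>shift\<close>, the conditioning event is itself invariant, so translation invariance
  survives along with stationarity.\<close>

lemma condition_parity_TIS:
  assumes \<mu>: "\<mu> \<in> TIS X_star" and B [measurable]: "B \<in> sets borel" and inv: "shift -` B = B"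
    and pos: "measure \<mu> (parity -` B) \<noteq> 0"
  shows "uniform_measure \<mu> (parity -` B) \<in> TIS X_star"
proof -
  have state: "state_on X_star \<mu>" and ti: "translation_invariant \<mu>" and stat: "stationary \<mu>"
    using \<mu> by (simp_all add: TIS_def)
  interpret prob_space \<mu> using state by (simp add: state_on_def)
  have sets [measurable_cong]: "sets \<mu> = sets borel" using state by (simp add: state_on_def)
  note cond = state_on_condition_parity[OF state B pos] stationary_condition_parity[OF state B pos stat]
  have "translation_invariant (uniform_measure \<mu> (parity -` B))"
  proof (rule translation_invariantI[OF cond(1)])
    fix A :: "config set" assume [measurable]: "A \<in> sets borel"
    have um: "measure (uniform_measure \<mu> (parity -` B)) D = prob (parity -` B \<inter> D) / prob (parity -` B)"
      if "D \<in> sets borel" for D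
      by (rule measure_uniform_measure) (use that pos in \<open>simp_all add: emeasure_eq_measure sets\<close>)
    have "shift -` (parity -` B) = parity -` (shift -` B)" by (auto simp: parity_shift)
    then have "parity -` B \<inter> shift -` A = shift -` (parity -` B \<inter> A)" by (simp add: inv)
    then show "measure (uniform_measure \<mu> (parity -` B)) (shift -` A) =
        measure (uniform_measure \<mu> (parity -` B)) A"
      using translation_invariant_measure[OF ti sets, of "parity -` B \<inter> A"] by (simp add: um)
  qed
  then show ?thesis using cond by (simp add: TIS_def)
qed

lemma ETIS_parity_ergodic:
  assumes etis: "ETIS X_star \<mu>"
  shows "ergodic (distr \<mu> borel parity)"
proof -
  have \<mu>: "\<mu> \<in> TIS X_star" using etis by (simp add: ETIS_def extremal_in_def)
  then have state: "state_on X_star \<mu>" and ti: "translation_invariant \<mu>" by (simp_all add: TIS_def)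
  interpret prob_space \<mu> using state by (simp add: state_on_def)
  have sets [measurable_cong]: "sets \<mu> = sets borel" using state by (simp add: state_on_def)
  have space [simp]: "space \<mu> = UNIV" using sets_eq_imp_space_eq[OF sets] by simp
  have "prob (parity -` B) = 0 \<or> prob (parity -` B) = 1"
    if B [measurable]: "B \<in> sets borel" and inv: "shift -` B = B" for B
  proof (rule ccontr)
    let ?C = "parity -` B" and ?D = "parity -` (- B)"
    assume "\<not> ?thesis"
    then have p: "0 < prob ?C" "prob ?C < 1"
      using prob_le_1[of ?C] measure_nonneg[of \<mu> ?C] by linarith+
    have D: "?D = - ?C" by auto
    have [measurable]: "- B \<in> sets borel" using sets.compl_sets[OF B] by (simp add: Compl_eq_Diff_UNIV)
    have "prob ?D = 1 - prob ?C"
      unfolding D using prob_compl[of ?C] by (simp add: Compl_eq_Diff_UNIV)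
    then have q: "prob ?D = 1 - prob ?C" "prob ?D \<noteq> 0" using p by simp_all
    have "shift -` (- B) = - B" using inv by auto
    then have TIS: "uniform_measure \<mu> ?C \<in> TIS X_star" "uniform_measure \<mu> ?D \<in> TIS X_star"
      using p q inv by (simp_all add: condition_parity_TIS[OF \<mu>])
    have um: "measure (uniform_measure \<mu> C) A = prob (C \<inter> A) / prob C"
      if "A \<in> sets borel" "C \<in> sets borel" "prob C \<noteq> 0" for A C
      by (rule measure_uniform_measure) (use that in \<open>simp_all add: emeasure_eq_measure sets\<close>)
    have "prob A = prob ?C * measure (uniform_measure \<mu> ?C) A + (1 - prob ?C) * measure (uniform_measure \<mu> ?D) A"
      if "A \<in> sets \<mu>" for A
    proof -
      have A [measurable]: "A \<in> sets borel" using that by (simp add: sets)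
      have "prob A = prob (?C \<inter> A \<union> ?D \<inter> A)" by (rule arg_cong[where f = prob]) auto
      also have "\<dots> = prob (?C \<inter> A) + prob (?D \<inter> A)"
        by (rule finite_measure_Union) auto
      finally show ?thesis using p q by (simp add: um)
    qed
    \<comment> \<open>The state is the mixture of its two conditional laws; extremality identifies
      it with the first, which gives \<open>?C\<close> mass one.\<close>
    then have "uniform_measure \<mu> ?C = \<mu>"
      using etis TIS p unfolding ETIS_def extremal_in_def by blast
    then have "prob ?C = 1" using um[of ?C ?C] p by simp
    then show False using p by simp
  qed
  then show ?thesis
    unfolding ergodic_def using translation_invariant_distr[OF ti sets measurable_parity parity_shift]
    by (simp add: measure_distr)
qed

section \<open>Passing decompositions between a product and its even factor\<close>

lemma TIS_gamma_push:
  assumes all_ti: "\<And>\<eta>. state_on X_star_even \<eta> \<Longrightarrow> stationary \<eta> \<Longrightarrow> translation_invariant \<eta>"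
    and "state_on X_star_even \<nu>" "stationary \<nu>" "state_on S_bin l" "translation_invariant l"
  shows "gamma_push \<nu> l \<in> TIS X_star"
  using assms(2-) all_ti[OF assms(2,3)]
  by (simp add: TIS_def state_on_gamma_push stationary_gamma_push translation_invariant_gamma_push)

lemma mixture_absolutely_continuous:
  fixes p :: real
  assumes fin: "finite_measure \<mu>" "finite_measure \<mu>\<^sub>1" and sets: "sets \<mu>\<^sub>1 = sets \<mu>" and p: "0 < p" "p < 1"
    and mix: "\<And>B. B \<in> sets \<mu> \<Longrightarrow> measure \<mu> B = p * measure \<mu>\<^sub>1 B + (1 - p) * measure \<mu>\<^sub>2 B"
  shows "absolutely_continuous \<mu> \<mu>\<^sub>1"
  unfolding absolutely_continuous_def
proof
  interpret M: finite_measure \<mu> by fact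
  interpret M1: finite_measure \<mu>\<^sub>1 by fact
  fix B assume "B \<in> null_sets \<mu>"
  then have B: "B \<in> sets \<mu>" and "measure \<mu> B = 0" by (auto simp: null_sets_def measure_def)
  with mix[OF B] p have "p * measure \<mu>\<^sub>1 B + (1 - p) * measure \<mu>\<^sub>2 B = 0"
    "0 \<le> (1 - p) * measure \<mu>\<^sub>2 B" "0 \<le> p * measure \<mu>\<^sub>1 B" by simp_all
  then have "p * measure \<mu>\<^sub>1 B = 0" by linarith
  then have "measure \<mu>\<^sub>1 B = 0" using p by simp
  then show "B \<in> null_sets \<mu>\<^sub>1" using B sets by (simp add: null_sets_def M1.emeasure_eq_measure)
qed

text \<open>Domination passes to both marginals. The parity marginal is invariant and dominated by
  the ergodic \<open>l\<close>, so it equals \<open>l\<close>, and \<open>TIS_product\<close>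
  applies; the even marginal inherits the density of \<open>\<nu>\<close>. This puts the components
  of a product state where extremality of the even factor can be tested.\<close>

lemma TIS_absolutely_continuous_product:
  assumes all_ti: "\<And>\<eta>. state_on X_star_even \<eta> \<Longrightarrow> stationary \<eta> \<Longrightarrow> translation_invariant \<eta>"
    and \<mu>: "\<mu> \<in> TIS X_star" and \<nu>: "\<nu> \<in> stationary_even \<sigma>"
    and l: "state_on S_bin l" and erg: "ergodic l"
    and ac: "absolutely_continuous (gamma_push \<nu> l) \<mu>"
  shows "distr \<mu> borel even_part \<in> stationary_even \<sigma>"
    and "\<mu> = gamma_push (distr \<mu> borel even_part) l"
proof -
  have state: "state_on X_star \<mu>" and ti: "translation_invariant \<mu>" and stat: "stationary \<mu>"
    using \<mu> by (simp_all add: TIS_def)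
  have \<nu>_state: "state_on X_star_even \<nu>" and dens: "has_density \<nu> \<sigma>"
    using \<nu> by (simp_all add: stationary_even_def)
  interpret prob_space \<mu> using state by (simp add: state_on_def)
  have sets [measurable_cong]: "sets \<mu> = sets borel" using state by (simp add: state_on_def)
  have sets_l: "sets l = sets borel" and sets_\<nu>: "sets \<nu> = sets borel"
    using l \<nu>_state by (simp_all add: state_on_def)
  let ?l = "distr \<mu> borel parity" and ?e = "distr \<mu> borel even_part"
  have "absolutely_continuous (distr (gamma_push \<nu> l) borel parity) ?l"
    by (rule absolutely_continuous_distr[OF ac]) (simp_all add: sets)
  then have ac_l: "absolutely_continuous l ?l"
    by (simp only: distr_parity_gamma_push[OF \<nu>_state l])
  have "absolutely_continuous (distr (gamma_push \<nu> l) borel even_part) ?e"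
    by (rule absolutely_continuous_distr[OF ac]) (simp_all add: sets)
  then have ac_e: "absolutely_continuous \<nu> ?e"
    by (simp only: distr_even_part_gamma_push[OF \<nu>_state l])
  interpret L: prob_space ?l by (rule prob_space_distr) simp
  interpret l: prob_space l using l by (simp add: state_on_def)
  have l_ti: "translation_invariant ?l"
    by (rule translation_invariant_distr[OF ti sets measurable_parity parity_shift])
  have "?l = l"
  proof (rule measure_eqI)
    fix B assume "B \<in> sets ?l"
    then have B: "B \<in> sets borel" by simp
    have "measure ?l B = measure l B * measure ?l UNIV"
      by (rule ergodic_absolutely_continuous_shift[OF l erg L.finite_measure_axioms _ ac_l
            translation_invariant_measure[OF l_ti] B]) simp_all
    moreover have "measure ?l UNIV = 1" using L.prob_space by simp
    ultimately show "emeasure ?l B = emeasure l B"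
      by (simp only: L.emeasure_eq_measure l.emeasure_eq_measure mult_1_right)
  qed (simp add: sets_l)
  then show "\<mu> = gamma_push ?e l"
    using TIS_product[OF all_ti \<mu>] erg by simp
  have "has_density ?e \<sigma>"
    using absolutely_continuous_AE[OF _ ac_e dens[unfolded has_density_def]]
    by (simp add: has_density_def sets_\<nu>)
  then show "?e \<in> stationary_even \<sigma>"
    using state_on_X_star_even_distr_even_part[OF state] stationary_distr_even_part[OF state stat]
    by (simp add: stationary_even_def)
qed

text \<open>For extremality of the even part, a decomposition of it is lifted by
  \<open>gamma_push\<close> with the parity law held fixed. The lifted states are TIS by the
  hypothesis, hence equal to \<open>\<mu>\<close>, and \<open>even_part\<close> recovers the
  original components.\<close>

lemma ETIS_imp_product:
  assumes all_ti: "\<And>\<eta>. state_on X_star_even \<eta> \<Longrightarrow> stationary \<eta> \<Longrightarrow> translation_invariant \<eta>"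
    and etis: "ETIS X_star \<mu>" and dens: "has_density \<mu> \<rho>"
  shows "\<exists>\<nu> \<kappa> \<mu>\<^sub>e. state_on S_bin \<nu> \<and> ergodic \<nu> \<and> has_density \<nu> \<kappa> \<and>
    extremal_in (stationary_even (\<rho> - \<kappa>)) \<mu>\<^sub>e \<and> \<mu> = gamma_push \<mu>\<^sub>e \<nu>"
proof -
  let ?l = "distr \<mu> borel parity" and ?e = "distr \<mu> borel even_part"
  have \<mu>: "\<mu> \<in> TIS X_star" using etis by (simp add: ETIS_def extremal_in_def)
  then have state: "state_on X_star \<mu>" and stat: "stationary \<mu>" by (simp_all add: TIS_def)
  have sets: "sets \<mu> = sets borel" using state by (simp add: state_on_def)
  have erg: "ergodic ?l" by (rule ETIS_parity_ergodic[OF etis])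
  have l: "state_on S_bin ?l" by (rule state_on_S_bin_distr_parity[OF state])
  have l_ti: "translation_invariant ?l" using erg by (simp add: ergodic_def)
  obtain \<kappa> where \<kappa>: "has_density ?l \<kappa>" by (rule ergodic_has_density[OF l erg])
  have prod: "\<mu> = gamma_push ?e ?l" by (rule TIS_product[OF all_ti \<mu> erg])
  have e_state: "state_on X_star_even ?e" by (rule state_on_X_star_even_distr_even_part[OF state])
  have e: "?e \<in> stationary_even (\<rho> - \<kappa>)"
    using e_state stationary_distr_even_part[OF state stat]
      has_density_distr_even_part[OF sets dens \<kappa>] by (simp add: stationary_even_def)
  have "\<nu>\<^sub>1 = ?e \<and> \<nu>\<^sub>2 = ?e"
    if \<nu>1: "\<nu>\<^sub>1 \<in> stationary_even (\<rho> - \<kappa>)" and \<nu>2: "\<nu>\<^sub>2 \<in> stationary_even (\<rho> - \<kappa>)" and p: "0 < p" "p < 1"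
      and mix: "\<forall>B\<in>sets ?e. measure ?e B = p * measure \<nu>\<^sub>1 B + (1 - p) * measure \<nu>\<^sub>2 B"
    for \<nu>\<^sub>1 \<nu>\<^sub>2 and p :: real
  proof -
    have s1: "state_on X_star_even \<nu>\<^sub>1" "stationary \<nu>\<^sub>1" and s2: "state_on X_star_even \<nu>\<^sub>2" "stationary \<nu>\<^sub>2"
      using \<nu>1 \<nu>2 by (simp_all add: stationary_even_def)
    have "measure \<mu> B = p * measure (gamma_push \<nu>\<^sub>1 ?l) B + (1 - p) * measure (gamma_push \<nu>\<^sub>2 ?l) B"
      if "B \<in> sets \<mu>" for B
    proof -
      have B [measurable]: "B \<in> sets borel" using that sets by simp
      \<comment> \<open>For fixed \<open>s\<close> the section is an event of the even part, to
        which \<open>mix\<close> applies; integrating over \<open>s\<close> makes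
        \<open>gamma_push\<close> affine in its first argument.\<close>
      have sec: "measure ?e {m. gamma (m, s) \<in> B} =
          p * measure \<nu>\<^sub>1 {m. gamma (m, s) \<in> B} + (1 - p) * measure \<nu>\<^sub>2 {m. gamma (m, s) \<in> B}" for s
      proof -
        have "{m \<in> space borel. gamma (m, s) \<in> B} \<in> sets borel" by measurable
        then show ?thesis using mix by simp
      qed
      have "measure \<mu> B = measure (gamma_push ?e ?l) B" using prod by simp
      also have "\<dots> = (\<integral> s. measure ?e {m. gamma (m, s) \<in> B} \<partial>?l)"
        by (rule measure_gamma_push[OF e_state l B])
      also have "\<dots> = p * measure (gamma_push \<nu>\<^sub>1 ?l) B + (1 - p) * measure (gamma_push \<nu>\<^sub>2 ?l) B"
        unfolding sec measure_gamma_push[OF s1(1) l B] measure_gamma_push[OF s2(1) l B]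
        using integrable_gamma_push_section[OF s1(1) l B] integrable_gamma_push_section[OF s2(1) l B]
        by (simp del: integral_distr)
      finally show ?thesis .
    qed
    moreover have "gamma_push \<nu>\<^sub>1 ?l \<in> TIS X_star" "gamma_push \<nu>\<^sub>2 ?l \<in> TIS X_star"
      using TIS_gamma_push[OF all_ti s1 l l_ti] TIS_gamma_push[OF all_ti s2 l l_ti] by simp_all
    ultimately have "gamma_push \<nu>\<^sub>1 ?l = \<mu> \<and> gamma_push \<nu>\<^sub>2 ?l = \<mu>"
      using etis p unfolding ETIS_def extremal_in_def by blast
    then show ?thesis
      using distr_even_part_gamma_push[OF s1(1) l] distr_even_part_gamma_push[OF s2(1) l] by simp
  qed
  then have "extremal_in (stationary_even (\<rho> - \<kappa>)) ?e"
    using e unfolding extremal_in_def by blast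
  then show ?thesis using l erg \<kappa> prod by blast
qed

text \<open>Each component of a mixture is dominated by it and so is a product with the same
  \<open>l\<close>. Projecting to even parts decomposes \<open>\<nu>\<close> within
  \<open>stationary_even \<sigma>\<close>; extremality there fixes both even factors and with them
  the components.\<close>

lemma product_imp_ETIS:
  assumes all_ti: "\<And>\<eta>. state_on X_star_even \<eta> \<Longrightarrow> stationary \<eta> \<Longrightarrow> translation_invariant \<eta>"
    and l: "state_on S_bin l" and erg: "ergodic l" and ext: "extremal_in (stationary_even \<sigma>) \<nu>"
  shows "ETIS X_star (gamma_push \<nu> l)"
proof -
  let ?\<mu> = "gamma_push \<nu> l"
  have \<nu>: "\<nu> \<in> stationary_even \<sigma>" using ext by (simp add: extremal_in_def)
  then have state: "state_on X_star_even \<nu>" "stationary \<nu>" by (simp_all add: stationary_even_def)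
  have l_ti: "translation_invariant l" using erg by (simp add: ergodic_def)
  have TIS: "?\<mu> \<in> TIS X_star" by (rule TIS_gamma_push[OF all_ti state l l_ti])
  have fin: "finite_measure \<mu>" if "\<mu> \<in> TIS X_star" for \<mu>
    using that by (simp add: TIS_def state_on_def prob_space_def)
  have sets: "sets \<mu> = sets borel" if "\<mu> \<in> TIS X_star" for \<mu>
    using that by (simp add: TIS_def state_on_def)
  have "\<mu>\<^sub>1 = ?\<mu> \<and> \<mu>\<^sub>2 = ?\<mu>"
    if \<mu>1: "\<mu>\<^sub>1 \<in> TIS X_star" and \<mu>2: "\<mu>\<^sub>2 \<in> TIS X_star" and p: "0 < p" "p < 1"
      and mix: "\<And>B. B \<in> sets ?\<mu> \<Longrightarrow> measure ?\<mu> B = p * measure \<mu>\<^sub>1 B + (1 - p) * measure \<mu>\<^sub>2 B"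
    for \<mu>\<^sub>1 \<mu>\<^sub>2 and p :: real
  proof -
    let ?e = "\<lambda>\<mu>. distr \<mu> borel even_part"
    have "absolutely_continuous ?\<mu> \<mu>\<^sub>1"
      by (rule mixture_absolutely_continuous[OF fin[OF TIS] fin[OF \<mu>1] _ p mix]) (simp_all add: sets[OF \<mu>1])
    note prod1 = TIS_absolutely_continuous_product[OF all_ti \<mu>1 \<nu> l erg this]
    \<comment> \<open>The roles are exchanged: the second component has weight
      \<open>1 - p\<close>.\<close>
    have "absolutely_continuous ?\<mu> \<mu>\<^sub>2"
      by (rule mixture_absolutely_continuous[OF fin[OF TIS] fin[OF \<mu>2], where p = "1 - p" and \<mu>\<^sub>2 = \<mu>\<^sub>1])
         (use p mix in \<open>simp_all add: sets[OF \<mu>2]\<close>)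
    note prod2 = TIS_absolutely_continuous_product[OF all_ti \<mu>2 \<nu> l erg this]
    have e: "measure (?e \<mu>) B = measure \<mu> (even_part -` B)"
      if "\<mu> \<in> TIS X_star" "B \<in> sets borel" for \<mu> B
      using measurable_even_part that sets_eq_imp_space_eq[OF sets[OF that(1)]]
      by (subst measure_distr) (simp_all add: measurable_cong_sets[OF sets[OF that(1)] refl])
    have "measure \<nu> B = p * measure (?e \<mu>\<^sub>1) B + (1 - p) * measure (?e \<mu>\<^sub>2) B" if "B \<in> sets \<nu>" for B
    proof -
      have B: "B \<in> sets borel" using that state(1) by (simp add: state_on_def)
      have "measure \<nu> B = measure (?e ?\<mu>) B"
        by (simp only: distr_even_part_gamma_push[OF state(1) l])
      also have "\<dots> = measure ?\<mu> (even_part -` B)" by (rule e[OF TIS B])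
      also have "\<dots> = p * measure \<mu>\<^sub>1 (even_part -` B) + (1 - p) * measure \<mu>\<^sub>2 (even_part -` B)"
        by (rule mix) (simp add: vimage_even_part_measurable[OF B])
      finally show ?thesis by (simp only: e[OF \<mu>1 B] e[OF \<mu>2 B])
    qed
    then have "?e \<mu>\<^sub>1 = \<nu> \<and> ?e \<mu>\<^sub>2 = \<nu>"
      using ext prod1(1) prod2(1) p unfolding extremal_in_def by blast
    then show ?thesis using prod1(2) prod2(2) by simp
  qed
  then show ?thesis using TIS unfolding ETIS_def extremal_in_def by blast
qed

theorem theoremB1:
  assumes "\<And>\<eta>. state_on X_star_even \<eta> \<Longrightarrow> stationary \<eta> \<Longrightarrow> translation_invariant \<eta>"
  shows "(\<forall>\<mu> \<rho>. ETIS X_star \<mu> \<and> has_density \<mu> \<rho> \<longrightarrow>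
            (\<exists>\<nu> \<kappa> \<mu>\<^sub>e. state_on S_bin \<nu> \<and> ergodic \<nu> \<and> has_density \<nu> \<kappa> \<and>
               extremal_in (stationary_even (\<rho> - \<kappa>)) \<mu>\<^sub>e \<and>
               \<mu> = gamma_push \<mu>\<^sub>e \<nu>))
       \<and> (\<forall>\<nu> \<kappa> \<mu>\<^sub>e \<rho>. state_on S_bin \<nu> \<and> ergodic \<nu> \<and> has_density \<nu> \<kappa> \<and>
            extremal_in (stationary_even (\<rho> - \<kappa>)) \<mu>\<^sub>e \<longrightarrow>
            ETIS X_star (gamma_push \<mu>\<^sub>e \<nu>))"
proof (intro conjI allI impI; elim conjE)
  fix \<mu> \<rho> assume "ETIS X_star \<mu>" "has_density \<mu> \<rho>"
  from ETIS_imp_product[OF assms this]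
  show "\<exists>\<nu> \<kappa> \<mu>\<^sub>e. state_on S_bin \<nu> \<and> ergodic \<nu> \<and> has_density \<nu> \<kappa> \<and>
      extremal_in (stationary_even (\<rho> - \<kappa>)) \<mu>\<^sub>e \<and> \<mu> = gamma_push \<mu>\<^sub>e \<nu>" .
next
  fix \<nu> \<kappa> \<mu>\<^sub>e \<rho>
  assume "state_on S_bin \<nu>" "ergodic \<nu>" "extremal_in (stationary_even (\<rho> - \<kappa>)) \<mu>\<^sub>e"
  from product_imp_ETIS[OF assms this] show "ETIS X_star (gamma_push \<mu>\<^sub>e \<nu>)" .
qed

end
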